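(* Let $d\in[1,+\infty)$ and let $G:\mathbb{D}\times[0,+\infty)\to\mathbb{C}$ be a Herglotz vector field of order $d$ on the unit disc $\mathbb{D}$. Then $G$ is semicomplete.
   Context: $\mathbb{D}=\{\zeta\in\mathbb{C}:|\zeta|<1\}$. Infinitesimal generator: a semigroup of holomorphic self-maps of $\mathbb{D}$ is a family $(\phi_t)_{t\ge0}$ of holomorphic self-maps of $\mathbb{D}$ with $\phi_0=\mathrm{id}$, $\phi_{t+s}=\phi_t\circ\phi_s$, and $\phi_t\to\mathrm{id}$ uniformly on compact sets as $t\to0$; its infinitesimal generator is the unique holomorphic $F:\mathbb{D}\to\mathbb{C}$ with $\frac{\partial\phi_t(z)}{\partial t}=F(\phi_t(z))$ for all $z\in\mathbb{D}$, $t\ge0$. $\mathrm{Gen}(\mathbb{D})$ denotes the set of all such generators. Herglotz vector field: a weak holomorphic vector field of order $d$ on $\mathbb{D}$ is a function $G:\mathbb{D}\times[0,+\infty)\to\mathbb{C}$ such that $t\mapsto G(z,t)$ is measurable for every $z\in\mathbb{D}$, $z\mapsto G(z,t)$ is holomorphic for every $t\ge0$, and for every compact $K\subset\mathbb{D}$ and $T>0$ there is a non-negative $k_{K,T}\in L^d([0,T],\mathbb{R})$ with $|G(z,t)|\le k_{K,T}(t)$ for all $z\in K$ and a.e. $t\in[0,T]$. It is a Herglotz vector field of order $d$ if moreover $G(\cdot,t)\in\mathrm{Gen}(\mathbb{D})$ for almost every $t\in[0,+\infty)$. Semicompleteness: for a weak holomorphic vector field $G$ and $(z,s)\in\mathbb{D}\times[0,+\infty)$,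 Carathéodory's theory of ODEs gives a unique maximal interval $[s,I(z,s))$, $s<I(z,s)\le+\infty$, and a unique function $x:[s,I(z,s))\to\mathbb{D}$, locally absolutely continuous, with $x(s)=z$ and $\dot x(t)=G(x(t),t)$ for a.e. $t\in[s,I(z,s))$ (maximal: any locally absolutely continuous $y:[s,I)\to\mathbb{D}$ solving the same problem satisfies $I\le I(z,s)$ and $y=x$ on $[s,I)$). $G$ is semicomplete if $I(z,s)=+\infty$ for all $(z,s)\in\mathbb{D}\times[0,+\infty)$. *)

theory Defs
  imports "HOL-Analysis.Analysis"
begin

text \<open>
  Functions on the disc are total functions on the complex numbers, and time-dependent objects
  are total in time. Every definition below only depends on their values for points of the disc
  and nonnegative times.
\<close>

abbreviation unit_disc :: "complex set" where
  "unit_disc \<equiv> ball 0 1"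


definition holomorphic_semigroup :: "(real \<Rightarrow> complex \<Rightarrow> complex) \<Rightarrow> bool" where
  "holomorphic_semigroup \<phi> \<longleftrightarrow>
     (\<forall>t\<ge>0. \<phi> t holomorphic_on unit_disc \<and> \<phi> t ` unit_disc \<subseteq> unit_disc) \<and>
     (\<forall>z\<in>unit_disc. \<phi> 0 z = z) \<and>
     (\<forall>t\<ge>0. \<forall>s\<ge>0. \<forall>z\<in>unit_disc. \<phi> (t + s) z = \<phi> t (\<phi> s z)) \<and>
     (\<forall>K. compact K \<and> K \<subseteq> unit_disc \<longrightarrow> uniform_limit K \<phi> (\<lambda>z. z) (at_right 0))"

text \<open>The derivative in time is one-sided at \<open>t = 0\<close> and two-sided at \<open>t > 0\<close>.\<close>

definition is_generator_of ::
  "(complex \<Rightarrow> complex) \<Rightarrow> (real \<Rightarrow> complex \<Rightarrow> complex) \<Rightarrow> bool" where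
  "is_generator_of F \<phi> \<longleftrightarrow>
     F holomorphic_on unit_disc \<and>
     (\<forall>z\<in>unit_disc. \<forall>t\<ge>0.
        ((\<lambda>r. \<phi> r z) has_vector_derivative F (\<phi> t z)) (at t within {0..}))"

definition Gen_disc :: "(complex \<Rightarrow> complex) set" where
  "Gen_disc = {F. \<exists>\<phi>. holomorphic_semigroup \<phi> \<and> is_generator_of F \<phi>}"


text \<open>
  Measurability in time is Lebesgue measurability. In the growth bound the exceptional null set of
  times may depend on \<open>z\<close>; by continuity of \<open>G\<close> in \<open>z\<close> and separability of \<open>K\<close> this is
  equivalent to asking for one null set that works for all \<open>z \<in> K\<close>.
\<close>

definition weak_holomorphic_vector_field ::
  "real \<Rightarrow> (complex \<Rightarrow> real \<Rightarrow> complex) \<Rightarrow> bool" where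
  "weak_holomorphic_vector_field d G \<longleftrightarrow>
     (\<forall>z\<in>unit_disc. (\<lambda>t. G z t) \<in> borel_measurable (lebesgue_on {0..})) \<and>
     (\<forall>t\<ge>0. (\<lambda>z. G z t) holomorphic_on unit_disc) \<and>
     (\<forall>K T. compact K \<and> K \<subseteq> unit_disc \<and> T > 0 \<longrightarrow>
        (\<exists>k :: real \<Rightarrow> real.
           (\<forall>t\<in>{0..T}. 0 \<le> k t) \<and>
           k \<in> borel_measurable (lebesgue_on {0..T}) \<and>
           integrable (lebesgue_on {0..T}) (\<lambda>t. k t powr d) \<and>
           (\<forall>z\<in>K. AE t in lebesgue_on {0..T}. norm (G z t) \<le> k t)))"

definition Herglotz_vector_field ::
  "real \<Rightarrow> (complex \<Rightarrow> real \<Rightarrow> complex) \<Rightarrow> bool" where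
  "Herglotz_vector_field d G \<longleftrightarrow>
     weak_holomorphic_vector_field d G \<and>
     (AE t in lebesgue_on {0..}. (\<lambda>z. G z t) \<in> Gen_disc)"


text \<open>
  The usual epsilon-delta definition; a finite family of non-overlapping subintervals \<open>[u, v]\<close> is
  encoded as the finite set of its endpoint pairs \<open>(u, v)\<close>.
\<close>

definition abs_continuous_on_Icc :: "real \<Rightarrow> real \<Rightarrow> (real \<Rightarrow> complex) \<Rightarrow> bool" where
  "abs_continuous_on_Icc a b x \<longleftrightarrow>
     (\<forall>\<epsilon>>0. \<exists>\<delta>>0. \<forall>P :: (real \<times> real) set.
        finite P \<and> (\<forall>(u, v)\<in>P. a \<le> u \<and> u < v \<and> v \<le> b) \<and>
        pairwise (\<lambda>(u, v) (u', v'). {u<..<v} \<inter> {u'<..<v'} = {}) P \<and>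
        (\<Sum>(u, v)\<in>P. v - u) < \<delta> \<longrightarrow>
        (\<Sum>(u, v)\<in>P. norm (x v - x u)) < \<epsilon>)"

text \<open>The interval \<open>[s, I)\<close>, where \<open>I\<close> may be infinite.\<close>

definition time_interval :: "real \<Rightarrow> ereal \<Rightarrow> real set" where
  "time_interval s I = {t. s \<le> t \<and> ereal t < I}"

definition locally_abs_continuous_on :: "real set \<Rightarrow> (real \<Rightarrow> complex) \<Rightarrow> bool" where
  "locally_abs_continuous_on J x \<longleftrightarrow>
     (\<forall>a b. a \<le> b \<and> {a..b} \<subseteq> J \<longrightarrow> abs_continuous_on_Icc a b x)"

definition solves_ivp ::
  "(complex \<Rightarrow> real \<Rightarrow> complex) \<Rightarrow> complex \<Rightarrow> real \<Rightarrow> ereal \<Rightarrow> (real \<Rightarrow> complex) \<Rightarrow> bool" where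
  "solves_ivp G z s I x \<longleftrightarrow>
     ereal s < I \<and>
     x ` time_interval s I \<subseteq> unit_disc \<and>
     locally_abs_continuous_on (time_interval s I) x \<and>
     x s = z \<and>
     (AE t in lebesgue_on (time_interval s I).
        (x has_vector_derivative G (x t) t) (at t within time_interval s I))"

definition maximal_solution ::
  "(complex \<Rightarrow> real \<Rightarrow> complex) \<Rightarrow> complex \<Rightarrow> real \<Rightarrow> ereal \<Rightarrow> (real \<Rightarrow> complex) \<Rightarrow> bool" where
  "maximal_solution G z s I x \<longleftrightarrow>
     solves_ivp G z s I x \<and>
     (\<forall>J y. solves_ivp G z s J y \<longrightarrow> J \<le> I \<and> (\<forall>t\<in>time_interval s J. y t = x t))"

lemma maximal_solution_unique:
  assumes "maximal_solution G z s I x" "maximal_solution G z s J y"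
  shows "I = J" "\<forall>t\<in>time_interval s I. x t = y t"
  using assms unfolding maximal_solution_def by (blast intro: antisym)+

text \<open>
  By \<open>maximal_solution_unique\<close> the endpoint of a maximal solution is determined by
  \<open>G\<close>, \<open>z\<close> and \<open>s\<close>, so the condition below says that this endpoint \<open>I(z, s)\<close> is infinite.
\<close>

definition semicomplete :: "(complex \<Rightarrow> real \<Rightarrow> complex) \<Rightarrow> bool" where
  "semicomplete G \<longleftrightarrow> (\<forall>z\<in>unit_disc. \<forall>s\<ge>0. \<exists>x. maximal_solution G z s \<infinity> x)"

end

theory Submission
  imports Defs "HOL-Complex_Analysis.Riemann_Mapping"
begin

text \<open>
  A solution of a Caratheodory equation can only cease to exist by leaving every compact subset of the
  disc, so the point is to keep solutions away from the unit circle. Each generator \<open>F\<close> satisfies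
    \<open>z \<bullet> F z \<le> \<bar>F 0\<bar> * (1 - \<bar>z\<bar>\<^sup>2)\<close>
  (\<open>generator_radial_bound\<close>): this is the derivative at time \<open>0\<close> of the Schwarz-Pick inequality between
  the points \<open>z\<close> and \<open>0\<close> for the semigroup of \<open>F\<close>, an infinitesimal form of the fact that holomorphic
  self-maps do not increase hyperbolic distances. Along a solution \<open>x\<close> of \<open>x' = G x t\<close> it says that
  \<open>1 - \<bar>x\<bar>\<^sup>2\<close> decreases at a relative rate of at most \<open>2 * \<bar>G 0 t\<bar>\<close>. This rate is locally integrable
  in \<open>t\<close>, so Gronwall's inequality gives
    \<open>1 - \<bar>x t\<bar>\<^sup>2 \<ge> (1 - \<bar>z\<bar>\<^sup>2) * exp (- 2 * \<integral> \<bar>G 0 \<tau>\<bar> d\<tau>)\<close>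
  (\<open>generator_ode_norm_bound\<close>), which is bounded away from zero on every bounded time interval.

  The bound also takes the place of a continuation argument. It is known beforehand
  which disc of radius \<open>R < 1\<close> a solution on \<open>[s, T]\<close> must stay in; extending the field from there by the
  nearest-point projection gives a globally Lipschitz field, whose Picard operator is a contraction in
  a weighted norm on \<open>[s, T]\<close> (\<open>caratheodory_integral_equation\<close>), and the solution found never notices the
  modification (\<open>Herglotz_solution_exists\<close>). Solutions for growing \<open>T\<close> agree by uniqueness
  (\<open>Herglotz_solution_unique\<close>), and together they form the global one.

  Since the equations hold for almost every time only, two facts of real analysis carry the passage
  between derivatives and increments: indefinite integrals are differentiable almost everywhere
  (\<open>integral_has_vector_derivative_ae\<close>), and an absolutely continuous function with nonpositive
  derivative almost everywhere does not increase (\<open>abs_continuous_deriv_nonpos_imp_le\<close>).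
\<close>

section \<open>Differentiation of the Lebesgue integral\<close>

text \<open>
  Lebesgue's differentiation theorem on the line, from its one-sided form: right derivatives of the
  integrals of \<open>f\<close> and of its reflection \<open>t \<mapsto> f (- t)\<close> are the right and the left derivative of the
  integral of \<open>f\<close>.
\<close>

lemma integral_has_vector_derivative_ae:
  fixes f :: "real \<Rightarrow> 'a::euclidean_space"
  assumes f: "f integrable_on {a..b}"
  obtains N where "negligible N"
    "\<And>t. t \<in> {a<..<b} - N \<Longrightarrow> ((\<lambda>s. integral {a..s} f) has_vector_derivative f t) (at t)"
proof -
  define g where "g = (\<lambda>t. if t \<in> {a..b} then f t else 0)"
  have gint: "g integrable_on cbox c d" for c d
  proof -
    have "g integrable_on UNIV"
      unfolding g_def using f integrable_restrict_UNIV by blast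
    then show ?thesis by (rule integrable_on_subcbox) simp
  qed
  have "(\<lambda>t. g (- t)) integrable_on cbox c d" for c d
    using gint[of "-d" "-c"] integrable_reflect[of g d c] by (metis integrable_reflect minus_minus)
  then obtain N2 where N2: "negligible N2"
    "\<And>x e. \<lbrakk>x \<notin> N2; 0 < e\<rbrakk> \<Longrightarrow> \<exists>d>0. \<forall>h. 0 < h \<and> h < d \<longrightarrow>
        norm (integral (cbox x (x + h *\<^sub>R One)) (\<lambda>t. g (- t)) /\<^sub>R h ^ DIM(real) - g (- x)) < e"
    using integrable_ccontinuous_explicit[of "\<lambda>t. g (- t)"] by blast
  obtain N1 where N1: "negligible N1"
    "\<And>x e. \<lbrakk>x \<notin> N1; 0 < e\<rbrakk> \<Longrightarrow> \<exists>d>0. \<forall>h. 0 < h \<and> h < d \<longrightarrow>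
        norm (integral (cbox x (x + h *\<^sub>R One)) g /\<^sub>R h ^ DIM(real) - g x) < e"
    using integrable_ccontinuous_explicit[of g] gint by blast
  define N where "N = N1 \<union> uminus ` N2"
  have "negligible (uminus ` N2)"
    using N2(1) by (intro negligible_differentiable_image_negligible)
      (auto intro!: derivative_intros simp: differentiable_on_def)
  then have "negligible N"
    using N1(1) unfolding N_def by (rule negligible_Un[rotated])
  moreover have "((\<lambda>s. integral {a..s} f) has_vector_derivative f t) (at t)"
    if t: "t \<in> {a<..<b} - N" for t
  proof -
    have t1: "t \<notin> N1" and t2: "- t \<notin> N2" and ab: "a < t" "t < b"
      using t unfolding N_def by force+
    have gt: "g t = f t" using ab by (simp add: g_def)
    have incr: "integral {a..v} f - integral {a..u} f = integral {u..v} g"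
      if "a \<le> u" "u \<le> v" "v \<le> b" for u v
    proof -
      have "integral {a..u} f + integral {u..v} f = integral {a..v} f"
        using that f by (intro Henstock_Kurzweil_Integration.integral_combine)
          (auto intro: integrable_on_subinterval)
      moreover have "integral {u..v} g = integral {u..v} f"
        using that by (intro integral_cong) (auto simp: g_def)
      ultimately show ?thesis by (simp add: algebra_simps)
    qed
    have scale: "norm (I - h *\<^sub>R w) \<le> e * h"
      if "0 < h" "norm (I /\<^sub>R h - w) < e" for I w :: 'a and h e :: real
    proof -
      have "I - h *\<^sub>R w = h *\<^sub>R (I /\<^sub>R h - w)"
        using that(1) by (simp add: scaleR_diff_right)
      then have "norm (I - h *\<^sub>R w) = h * norm (I /\<^sub>R h - w)"
        using that(1) by simp
      then show ?thesis using that by (simp add: mult.commute)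
    qed
    show ?thesis
      unfolding has_vector_derivative_def has_derivative_at_alt
    proof (intro conjI allI impI bounded_linear_scaleR_left)
      fix e :: real assume e: "0 < e"
      obtain d1 where d1: "d1 > 0" "\<And>h. 0 < h \<Longrightarrow> h < d1 \<Longrightarrow>
          norm (integral {t..t + h} g /\<^sub>R h - g t) < e"
        using N1(2)[OF t1 e] by auto
      obtain d2 where d2: "d2 > 0" "\<And>h. 0 < h \<Longrightarrow> h < d2 \<Longrightarrow>
          norm (integral {-t..-t + h} (\<lambda>t. g (- t)) /\<^sub>R h - g t) < e"
        using N2(2)[OF t2 e] by auto
      define d where "d = Min {d1, d2, t - a, b - t}"
      have d: "d > 0" "d \<le> d1" "d \<le> d2" "d \<le> t - a" "d \<le> b - t"
        using d1 d2 ab by (auto simp: d_def)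
      show "\<exists>d>0. \<forall>y. norm (y - t) < d \<longrightarrow>
          norm (integral {a..y} f - integral {a..t} f - (y - t) *\<^sub>R f t) \<le> e * norm (y - t)"
      proof (intro exI conjI allI impI)
        fix y assume y: "norm (y - t) < d"
        consider "y = t" | "t < y" | "y < t" by linarith
        then show "norm (integral {a..y} f - integral {a..t} f - (y - t) *\<^sub>R f t) \<le> e * norm (y - t)"
        proof cases
          case 2
          have "integral {a..y} f - integral {a..t} f = integral {t..t + (y - t)} g"
            using incr[of t y] 2 y d ab by auto
          with scale[OF _ d1(2)[of "y - t"]] 2 y d show ?thesis by (auto simp: gt)
        next
          case 3
          have "integral {a..t} f - integral {a..y} f = integral {y..t} g"
            using incr[of y t] 3 y d ab by auto
          also have "\<dots> = integral {-t..-t + (t - y)} (\<lambda>t. g (- t))"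
            using integral_reflect_real[of t y g] by simp
          finally have "norm (integral {a..t} f - integral {a..y} f - (t - y) *\<^sub>R g t) \<le> e * (t - y)"
            using scale[OF _ d2(2)[of "t - y"]] 3 y d by auto
          moreover have "integral {a..y} f - integral {a..t} f - (y - t) *\<^sub>R f t
              = - (integral {a..t} f - integral {a..y} f - (t - y) *\<^sub>R g t)"
            by (simp add: gt algebra_simps)
          ultimately show ?thesis using 3 by (simp only: norm_minus_cancel) simp
        qed auto
      qed (use d in auto)
    qed
  qed
  ultimately show ?thesis using that by blast
qed

section \<open>Absolutely continuous functions\<close>

lemma sum_content_division_le_measure:
  fixes D :: "real set set"
  assumes D: "D division_of S" and "S \<subseteq> U" "U \<in> lmeasurable"
  shows "sum (measure lborel) D \<le> measure lebesgue U"
proof -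
  have S: "S \<in> lmeasurable"
    using D lmeasurable_division by blast
  have "sum (measure lborel) D = integral S (\<lambda>_. 1 :: real)"
  proof -
    have "(\<lambda>_. 1 :: real) integrable_on S"
      using S lmeasurable_iff_integrable_on by blast
    from integral_combine_division_topdown[OF this D]
    have "integral S (\<lambda>_. 1 :: real) = (\<Sum>K\<in>D. integral K (\<lambda>_. 1))" .
    also have "\<dots> = sum (measure lborel) D"
    proof (rule sum.cong)
      fix K assume "K \<in> D"
      then obtain u v where "K = cbox u v" using D by blast
      then show "integral K (\<lambda>_. 1 :: real) = measure lborel K" by simp
    qed simp
    finally show ?thesis by simp
  qed
  also have "\<dots> = measure lebesgue S" using S by (simp add: lmeasure_integral)
  also have "\<dots> \<le> measure lebesgue U"
    using S assms by (intro measure_mono_fmeasurable) (auto simp: fmeasurableD)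
  finally show ?thesis .
qed

text \<open>
  The families of nonoverlapping intervals in the definition of absolute continuity are divisions
  of their union, which makes the integral additive over them.
\<close>

lemma integral_intervals_le:
  fixes g :: "real \<Rightarrow> real"
  assumes g: "g integrable_on {a..b}" "\<And>t. t \<in> {a..b} \<Longrightarrow> 0 \<le> g t"
    and P: "finite P" "\<forall>(u, v)\<in>P. a \<le> u \<and> u < v \<and> v \<le> b"
      "pairwise (\<lambda>(u, v) (u', v'). {u<..<v} \<inter> {u'<..<v'} = {}) P"
  shows "(\<Sum>(u, v)\<in>P. integral {u..v} g) \<le> integral {a..b} g"
proof -
  define I where "I = (\<lambda>(u, v). {u..v::real})"
  have inj: "inj_on I P"
    using P(2) by (auto simp: inj_on_def I_def Icc_eq_Icc)
  have D: "I ` P division_of \<Union>(I ` P)"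
  proof (rule division_ofI)
    fix K assume "K \<in> I ` P"
    then obtain u v where uv: "(u, v) \<in> P" "K = {u..v}" by (auto simp: I_def)
    then show "K \<subseteq> \<Union>(I ` P)" "K \<noteq> {}" "\<exists>a b. K = cbox a b"
      using P(2) by (auto simp: I_def intro!: exI)
    fix L assume L: "L \<in> I ` P" "K \<noteq> L"
    then obtain u' v' where uv': "(u', v') \<in> P" "L = {u'..v'}" by (auto simp: I_def)
    have "(u, v) \<noteq> (u', v')" using uv uv' L by auto
    then show "interior K \<inter> interior L = {}"
      using P(3) uv uv' unfolding pairwise_def by (fastforce simp: interior_atLeastAtMost_real)
  qed (use P in auto)
  have sub: "\<Union>(I ` P) \<subseteq> {a..b}"
    using P(2) by (force simp: I_def)
  have int: "g integrable_on \<Union>(I ` P)"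
    using D g(1) sub integrable_on_subdivision by blast
  have "(\<Sum>(u, v)\<in>P. integral {u..v} g) = (\<Sum>K\<in>I ` P. integral K g)"
    using inj by (subst sum.reindex) (auto simp: I_def case_prod_unfold)
  also have "\<dots> = integral (\<Union>(I ` P)) g"
    using integral_combine_division_topdown[OF int D] by simp
  also have "\<dots> \<le> integral {a..b} g"
    using sub int g by (intro integral_subset_le) auto
  finally show ?thesis .
qed

lemma abs_continuous_on_Icc_subset:
  assumes "abs_continuous_on_Icc a b x" "a \<le> a'" "b' \<le> b"
  shows "abs_continuous_on_Icc a' b' x"
  unfolding abs_continuous_on_Icc_def
proof (intro allI impI)
  fix e :: real assume "0 < e"
  then obtain d where d: "d > 0" "\<And>P. finite P \<and> (\<forall>(u, v)\<in>P. a \<le> u \<and> u < v \<and> v \<le> b) \<and>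
        pairwise (\<lambda>(u, v) (u', v'). {u<..<v} \<inter> {u'<..<v'} = {}) P \<and>
        (\<Sum>(u, v)\<in>P. v - u) < d \<Longrightarrow> (\<Sum>(u, v)\<in>P. norm (x v - x u)) < e"
    using assms(1) unfolding abs_continuous_on_Icc_def by meson
  show "\<exists>d>0. \<forall>P. finite P \<and> (\<forall>(u, v)\<in>P. a' \<le> u \<and> u < v \<and> v \<le> b') \<and>
        pairwise (\<lambda>(u, v) (u', v'). {u<..<v} \<inter> {u'<..<v'} = {}) P \<and>
        (\<Sum>(u, v)\<in>P. v - u) < d \<longrightarrow> (\<Sum>(u, v)\<in>P. norm (x v - x u)) < e"
    using d(1) by (intro exI[of _ d] conjI allI impI d(2)) (use assms(2,3) in force)+
qed

text \<open>
  Sums, Lipschitz images and products of absolutely continuous functions have increments that are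
  dominated by those of the given functions, so this one criterion covers all of them. Real functions
  enter as their complex embeddings.
\<close>

lemma abs_continuous_on_Icc_controlled:
  assumes x: "abs_continuous_on_Icc a b x" and y: "abs_continuous_on_Icc a b y"
    and C: "\<And>u v. a \<le> u \<Longrightarrow> u < v \<Longrightarrow> v \<le> b \<Longrightarrow>
      norm (w v - w u) \<le> C * (norm (x v - x u) + norm (y v - y u))"
  shows "abs_continuous_on_Icc a b w"
  unfolding abs_continuous_on_Icc_def
proof (intro allI impI)
  fix e :: real assume e: "0 < e"
  define c where "c = e / (2 * (\<bar>C\<bar> + 1))"
  have c: "c > 0" using e by (simp add: c_def)
  obtain d1 where d1: "d1 > 0" "\<And>P. finite P \<and> (\<forall>(u, v)\<in>P. a \<le> u \<and> u < v \<and> v \<le> b) \<and>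
        pairwise (\<lambda>(u, v) (u', v'). {u<..<v} \<inter> {u'<..<v'} = {}) P \<and>
        (\<Sum>(u, v)\<in>P. v - u) < d1 \<Longrightarrow> (\<Sum>(u, v)\<in>P. norm (x v - x u)) < c"
    using x c unfolding abs_continuous_on_Icc_def by meson
  obtain d2 where d2: "d2 > 0" "\<And>P. finite P \<and> (\<forall>(u, v)\<in>P. a \<le> u \<and> u < v \<and> v \<le> b) \<and>
        pairwise (\<lambda>(u, v) (u', v'). {u<..<v} \<inter> {u'<..<v'} = {}) P \<and>
        (\<Sum>(u, v)\<in>P. v - u) < d2 \<Longrightarrow> (\<Sum>(u, v)\<in>P. norm (y v - y u)) < c"
    using y c unfolding abs_continuous_on_Icc_def by meson
  show "\<exists>d>0. \<forall>P. finite P \<and> (\<forall>(u, v)\<in>P. a \<le> u \<and> u < v \<and> v \<le> b) \<and>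
        pairwise (\<lambda>(u, v) (u', v'). {u<..<v} \<inter> {u'<..<v'} = {}) P \<and>
        (\<Sum>(u, v)\<in>P. v - u) < d \<longrightarrow> (\<Sum>(u, v)\<in>P. norm (w v - w u)) < e"
  proof (intro exI[of _ "min d1 d2"] conjI allI impI)
    fix P :: "(real \<times> real) set"
    assume P: "finite P \<and> (\<forall>(u, v)\<in>P. a \<le> u \<and> u < v \<and> v \<le> b) \<and>
        pairwise (\<lambda>(u, v) (u', v'). {u<..<v} \<inter> {u'<..<v'} = {}) P \<and>
        (\<Sum>(u, v)\<in>P. v - u) < min d1 d2"
    have "(\<Sum>(u, v)\<in>P. norm (w v - w u))
        \<le> (\<Sum>(u, v)\<in>P. (\<bar>C\<bar> + 1) * (norm (x v - x u) + norm (y v - y u)))"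
    proof (rule sum_mono, clarify)
      fix u v assume "(u, v) \<in> P"
      then have "norm (w v - w u) \<le> C * (norm (x v - x u) + norm (y v - y u))"
        using P by (intro C) auto
      also have "\<dots> \<le> (\<bar>C\<bar> + 1) * (norm (x v - x u) + norm (y v - y u))"
        by (intro mult_right_mono) auto
      finally show "norm (w v - w u) \<le> (\<bar>C\<bar> + 1) * (norm (x v - x u) + norm (y v - y u))" .
    qed
    also have "\<dots> = (\<bar>C\<bar> + 1) * ((\<Sum>(u, v)\<in>P. norm (x v - x u)) + (\<Sum>(u, v)\<in>P. norm (y v - y u)))"
      by (simp add: case_prod_unfold sum.distrib flip: sum_distrib_left)
    also have "\<dots> < (\<bar>C\<bar> + 1) * (c + c)"
      using P by (intro mult_strict_left_mono add_strict_mono d1(2) d2(2)) auto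
    also have "\<dots> = c * (2 * (\<bar>C\<bar> + 1))" by (simp add: algebra_simps)
    also have "\<dots> = e" by (simp add: c_def)
    finally show "(\<Sum>(u, v)\<in>P. norm (w v - w u)) < e" .
  qed (use d1 d2 in auto)
qed

lemma abs_continuous_on_Icc_cong:
  assumes "abs_continuous_on_Icc a b x" "\<And>t. t \<in> {a..b} \<Longrightarrow> x t = y t"
  shows "abs_continuous_on_Icc a b y"
  using assms(1)
  by (rule abs_continuous_on_Icc_controlled[where C = 1, OF _ assms(1)]) (use assms(2) in auto)

lemma abs_continuous_on_Icc_imp_continuous:
  assumes x: "abs_continuous_on_Icc a b x"
  shows "continuous_on {a..b} x"
  unfolding continuous_on_iff
proof (intro ballI allI impI)
  fix t e :: real assume t: "t \<in> {a..b}" and e: "0 < e"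
  obtain d where d: "d > 0" "\<And>P. finite P \<and> (\<forall>(u, v)\<in>P. a \<le> u \<and> u < v \<and> v \<le> b) \<and>
        pairwise (\<lambda>(u, v) (u', v'). {u<..<v} \<inter> {u'<..<v'} = {}) P \<and>
        (\<Sum>(u, v)\<in>P. v - u) < d \<Longrightarrow> (\<Sum>(u, v)\<in>P. norm (x v - x u)) < e"
    using x e unfolding abs_continuous_on_Icc_def by meson
  have one: "dist (x v) (x u) < e" if "a \<le> u" "u < v" "v \<le> b" "v - u < d" for u v
    using d(2)[of "{(u, v)}"] that by (simp add: dist_norm)
  have "dist (x s) (x t) < e" if "s \<in> {a..b}" "dist s t < d" for s
  proof -
    consider "s = t" | "s < t" | "t < s" by linarith
    then show ?thesis
      using one[of s t] one[of t s] that t e by cases (auto simp: dist_real_def dist_commute)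
  qed
  then show "\<exists>d>0. \<forall>s\<in>{a..b}. dist s t < d \<longrightarrow> dist (x s) (x t) < e"
    using d(1) by blast
qed

lemma abs_continuous_on_Icc_bounded:
  assumes "abs_continuous_on_Icc a b x"
  obtains B where "B > 0" "\<And>t. t \<in> {a..b} \<Longrightarrow> norm (x t) \<le> B"
  using compact_imp_bounded[OF compact_continuous_image[OF abs_continuous_on_Icc_imp_continuous[OF assms]]]
  unfolding bounded_pos by auto

lemma abs_continuous_on_Icc_mult:
  assumes x: "abs_continuous_on_Icc a b x" and y: "abs_continuous_on_Icc a b y"
  shows "abs_continuous_on_Icc a b (\<lambda>t. x t * y t)"
proof -
  obtain A where A: "A > 0" "\<And>t. t \<in> {a..b} \<Longrightarrow> norm (x t) \<le> A"
    using abs_continuous_on_Icc_bounded[OF x] by metis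
  obtain B where B: "B > 0" "\<And>t. t \<in> {a..b} \<Longrightarrow> norm (y t) \<le> B"
    using abs_continuous_on_Icc_bounded[OF y] by metis
  show ?thesis
  proof (rule abs_continuous_on_Icc_controlled[OF x y])
    fix u v assume uv: "a \<le> u" "u < v" "v \<le> b"
    have "x v * y v - x u * y u = (x v - x u) * y v + x u * (y v - y u)"
      by (simp add: algebra_simps)
    then have "norm (x v * y v - x u * y u) \<le> norm (x v - x u) * norm (y v) + norm (x u) * norm (y v - y u)"
      by (metis norm_mult norm_triangle_ineq)
    also have "\<dots> \<le> norm (x v - x u) * (A + B) + (A + B) * norm (y v - y u)"
      using A(2)[of u] B(2)[of v] uv A(1) B(1)
      by (intro add_mono mult_left_mono mult_right_mono) auto
    finally show "norm (x v * y v - x u * y u) \<le> (A + B) * (norm (x v - x u) + norm (y v - y u))"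
      by (simp add: algebra_simps)
  qed
qed

lemma abs_continuous_on_Icc_exp:
  assumes x: "abs_continuous_on_Icc a b x"
  shows "abs_continuous_on_Icc a b (\<lambda>t. exp (x t))"
proof -
  obtain B where B: "B > 0" "\<And>t. t \<in> {a..b} \<Longrightarrow> norm (x t) \<le> B"
    using abs_continuous_on_Icc_bounded[OF x] by metis
  show ?thesis
  proof (rule abs_continuous_on_Icc_controlled[OF x x])
    fix u v assume uv: "a \<le> u" "u < v" "v \<le> b"
    have "norm (exp (x v) - exp (x u)) \<le> exp B * norm (x v - x u)"
    proof (rule field_differentiable_bound[of "cball 0 B"])
      fix z :: complex assume "z \<in> cball 0 B"
      then show "norm (exp z) \<le> exp B"
        using order_trans[OF norm_exp[of z], of "exp B"] by simp
    qed (use B(2)[of u] B(2)[of v] uv in \<open>auto intro!: derivative_eq_intros\<close>)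
    also have "\<dots> \<le> exp B * (norm (x v - x u) + norm (x v - x u))"
      by (intro mult_left_mono) auto
    finally show "norm (exp (x v) - exp (x u)) \<le> exp B * (norm (x v - x u) + norm (x v - x u))" .
  qed
qed

text \<open>
  Absolute continuity of the integral: truncating \<open>g\<close> at a high level \<open>n\<close> leaves a remainder of small
  integral, and over intervals of total length below \<open>\<delta>\<close> the truncated part contributes at most
  \<open>n * \<delta>\<close>.
\<close>

lemma abs_continuous_on_Icc_integral_bound:
  fixes g :: "real \<Rightarrow> real"
  assumes g: "g integrable_on {a..b}" "\<And>t. t \<in> {a..b} \<Longrightarrow> 0 \<le> g t"
    and x: "\<And>u v. a \<le> u \<Longrightarrow> u < v \<Longrightarrow> v \<le> b \<Longrightarrow> norm (x v - x u) \<le> integral {u..v} g"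
  shows "abs_continuous_on_Icc a b x"
  unfolding abs_continuous_on_Icc_def
proof (intro allI impI)
  fix e :: real assume e: "0 < e"
  have gabs: "g absolutely_integrable_on {a..b}"
    using g by (intro nonnegative_absolutely_integrable_1) auto
  have mint: "(\<lambda>t. min (g t) (real n)) integrable_on {a..b}" for n
    using gabs absolutely_integrable_min_1[OF gabs, of "\<lambda>_. real n"]
    by (simp add: set_lebesgue_integral_eq_integral(1))
  have "(\<lambda>n. integral {a..b} (\<lambda>t. min (g t) (real n))) \<longlonglongrightarrow> integral {a..b} g"
  proof (rule dominated_convergence(2)[OF mint g(1)])
    fix t assume "t \<in> {a..b}"
    show "(\<lambda>n. min (g t) (real n)) \<longlonglongrightarrow> g t"
    proof (rule tendsto_eventually)
      show "\<forall>\<^sub>F n in sequentially. min (g t) (real n) = g t"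
        using eventually_ge_at_top[of "nat \<lceil>g t\<rceil>"] by eventually_elim linarith
    qed
  qed (use g(2) in auto)
  then have "\<forall>\<^sub>F n in sequentially. integral {a..b} (\<lambda>t. min (g t) (real n)) > integral {a..b} g - e/2"
    using e by (intro order_tendstoD(1)) auto
  then obtain n where n: "integral {a..b} (\<lambda>t. min (g t) (real n)) > integral {a..b} g - e/2"
    by (meson eventually_sequentially order_refl)
  define r where "r = (\<lambda>t. g t - min (g t) (real n))"
  have r: "r integrable_on {a..b}" "\<And>t. 0 \<le> r t" "integral {a..b} r < e/2"
    using n integral_diff[OF g(1) mint[of n]] integrable_diff[OF g(1) mint[of n]]
    by (auto simp: r_def)
  define d where "d = e / (2 * (real n + 1))"
  show "\<exists>d>0. \<forall>P. finite P \<and> (\<forall>(u, v)\<in>P. a \<le> u \<and> u < v \<and> v \<le> b) \<and>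
        pairwise (\<lambda>(u, v) (u', v'). {u<..<v} \<inter> {u'<..<v'} = {}) P \<and>
        (\<Sum>(u, v)\<in>P. v - u) < d \<longrightarrow> (\<Sum>(u, v)\<in>P. norm (x v - x u)) < e"
  proof (intro exI[of _ d] conjI allI impI)
    show "d > 0" using e by (simp add: d_def)
    fix P :: "(real \<times> real) set"
    assume P: "finite P \<and> (\<forall>(u, v)\<in>P. a \<le> u \<and> u < v \<and> v \<le> b) \<and>
        pairwise (\<lambda>(u, v) (u', v'). {u<..<v} \<inter> {u'<..<v'} = {}) P \<and>
        (\<Sum>(u, v)\<in>P. v - u) < d"
    have "(\<Sum>(u, v)\<in>P. norm (x v - x u)) \<le> (\<Sum>(u, v)\<in>P. integral {u..v} r + real n * (v - u))"
    proof (rule sum_mono, clarify)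
      fix u v assume "(u, v) \<in> P"
      then have uv: "a \<le> u" "u < v" "v \<le> b" using P by auto
      have rs: "r integrable_on {u..v}"
        using r(1) uv by (auto intro: integrable_on_subinterval)
      have "norm (x v - x u) \<le> integral {u..v} g" using x uv by auto
      also have "\<dots> \<le> integral {u..v} (\<lambda>t. r t + real n)"
        using g(1) uv rs
        by (intro integral_le integrable_add) (auto intro: integrable_on_subinterval simp: r_def)
      also have "\<dots> = integral {u..v} r + real n * (v - u)"
        using rs uv by (subst integral_add) auto
      finally show "norm (x v - x u) \<le> integral {u..v} r + real n * (v - u)" .
    qed
    also have "\<dots> = (\<Sum>(u, v)\<in>P. integral {u..v} r) + real n * (\<Sum>(u, v)\<in>P. v - u)"
      by (simp add: case_prod_unfold sum.distrib sum_distrib_left)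
    also have "\<dots> \<le> integral {a..b} r + (real n + 1) * d"
    proof (intro add_mono mult_mono)
      show "(\<Sum>(u, v)\<in>P. integral {u..v} r) \<le> integral {a..b} r"
        using P r by (intro integral_intervals_le) auto
      show "0 \<le> (\<Sum>(u, v)\<in>P. v - u)" using P by (intro sum_nonneg) auto
    qed (use P in auto)
    also have "(real n + 1) * d = e / 2" by (simp add: d_def field_simps)
    also have "integral {a..b} r + e / 2 < e" using r by simp
    finally show "(\<Sum>(u, v)\<in>P. norm (x v - x u)) < e" .
  qed
qed

lemma abs_continuous_on_Icc_integral:
  fixes f :: "real \<Rightarrow> 'a::euclidean_space"
  assumes f: "f absolutely_integrable_on {a..b}"
    and x: "\<And>u v. a \<le> u \<Longrightarrow> u < v \<Longrightarrow> v \<le> b \<Longrightarrow> norm (x v - x u) \<le> norm (integral {a..v} f - integral {a..u} f)"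
  shows "abs_continuous_on_Icc a b x"
proof (rule abs_continuous_on_Icc_integral_bound[of "\<lambda>t. norm (f t)"])
  show n: "(\<lambda>t. norm (f t)) integrable_on {a..b}"
    using f unfolding absolutely_integrable_on_def by auto
  fix u v assume uv: "a \<le> u" "u < v" "v \<le> b"
  have fi: "f integrable_on {a..b}" using f unfolding absolutely_integrable_on_def by auto
  have "integral {a..u} f + integral {u..v} f = integral {a..v} f"
    using uv fi by (intro Henstock_Kurzweil_Integration.integral_combine)
      (auto intro: integrable_on_subinterval)
  then have "integral {a..v} f - integral {a..u} f = integral {u..v} f"
    by (simp add: algebra_simps)
  moreover have "norm (integral {u..v} f) \<le> integral {u..v} (\<lambda>t. norm (f t))"
    using fi n uv by (intro integral_norm_bound_integral) (auto intro: integrable_on_subinterval)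
  ultimately show "norm (x v - x u) \<le> integral {u..v} (\<lambda>t. norm (f t))"
    using x[OF uv] by simp
qed auto

section \<open>Differential inequalities that hold almost everywhere\<close>

text \<open>
  The bridge from almost everywhere to everywhere. By Cousin's lemma the interval has a tagged
  division so fine that each piece with a tag outside the exceptional null set contributes at most
  \<open>e\<close> times its length to the increment of \<open>h\<close>, while all pieces with a tag inside lie in an open set
  of tiny measure. Absolute continuity bounds the contribution of the latter by \<open>e\<close>.
\<close>

lemma abs_continuous_deriv_nonpos_imp_le:
  fixes h h' :: "real \<Rightarrow> real"
  assumes "a \<le> b" and ac: "abs_continuous_on_Icc a b (\<lambda>t. of_real (h t))"
    and N: "negligible N"
    and h': "\<And>t. t \<in> {a<..<b} - N \<Longrightarrow> (h has_vector_derivative h' t) (at t)"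
      "\<And>t. t \<in> {a<..<b} - N \<Longrightarrow> h' t \<le> 0"
  shows "h b \<le> h a"
proof -
  have main: "h b - h a \<le> e * (b - a + 1)" if e: "0 < e" for e
  proof -
    obtain \<delta> where \<delta>: "\<delta> > 0" "\<And>P. finite P \<and> (\<forall>(u, v)\<in>P. a \<le> u \<and> u < v \<and> v \<le> b) \<and>
        pairwise (\<lambda>(u, v) (u', v'). {u<..<v} \<inter> {u'<..<v'} = {}) P \<and>
        (\<Sum>(u, v)\<in>P. v - u) < \<delta> \<Longrightarrow> (\<Sum>(u, v)\<in>P. norm (complex_of_real (h v) - complex_of_real (h u))) < e"
      using ac e unfolding abs_continuous_on_Icc_def by meson
    \<comment> \<open>The endpoints join the null set because the derivative is known in the interior only.\<close>
    define N' where "N' = N \<union> {a, b}"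
    have N': "negligible N'" using N unfolding N'_def by (simp add: insert_commute)
    have N'null: "emeasure lebesgue N' = 0" "N' \<in> sets lebesgue"
      using N' by (auto simp: negligible_iff_null_sets)
    obtain U where U: "open U" "N' \<subseteq> U" "U - N' \<in> lmeasurable" "emeasure lebesgue (U - N') < ennreal \<delta>"
      using sets_lebesgue_outer_open[OF N'null(2) \<delta>(1)] by metis
    have "U = (U - N') \<union> N'" using U(2) by blast
    then have Umeas: "U \<in> lmeasurable" "measure lebesgue U < \<delta>"
    proof -
      have N'l: "N' \<in> lmeasurable" "measure lebesgue N' = 0"
        using N' by (auto simp: negligible_imp_measurable negligible_imp_measure0)
      show "U \<in> lmeasurable"
        using fmeasurable.Un[OF U(3) N'l(1)] \<open>U = (U - N') \<union> N'\<close> by simp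
      have "measure lebesgue U \<le> measure lebesgue (U - N') + measure lebesgue N'"
        using measure_Un_le[of "U - N'" lebesgue N'] U(3) N'l \<open>U = (U - N') \<union> N'\<close>
        by (simp add: fmeasurableD)
      also have "\<dots> < \<delta>"
        using U(3,4) N'l(2) \<delta>(1) by (simp add: emeasure_eq_measure2 ennreal_less_iff)
      finally show "measure lebesgue U < \<delta>" .
    qed
    have "\<exists>r>0. \<forall>y. \<bar>y - t\<bar> < r \<longrightarrow> \<bar>h y - h t - (y - t) * h' t\<bar> \<le> e * \<bar>y - t\<bar>"
      if "t \<in> {a<..<b} - N" for t
      using h'(1)[OF that] e unfolding has_vector_derivative_def has_derivative_at_alt by auto
    then obtain r where r: "\<And>t. t \<in> {a<..<b} - N \<Longrightarrow> r t > 0"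
      "\<And>t y. t \<in> {a<..<b} - N \<Longrightarrow> \<bar>y - t\<bar> < r t \<Longrightarrow> \<bar>h y - h t - (y - t) * h' t\<bar> \<le> e * \<bar>y - t\<bar>"
      by metis
    define \<gamma> where "\<gamma> = (\<lambda>t. if t \<in> {a<..<b} - N then ball t (r t) else if t \<in> N' then U else UNIV)"
    have "gauge \<gamma>"
      unfolding gauge_def \<gamma>_def using r(1) U(1,2) by auto
    then obtain p where p: "p tagged_division_of {a..b}" "\<gamma> fine p"
      using fine_division_exists_real by blast
    note pD = tagged_division_ofD[OF p(1)]
    \<comment> \<open>Degenerate pieces are left out so that the intervals determine the pieces.\<close>
    define q where "q = {z \<in> p. fst z \<in> N' \<and> Inf (snd z) < Sup (snd z)}"
    have K: "\<exists>u v. K = {u..v} \<and> u \<le> t \<and> t \<le> v \<and> a \<le> u \<and> v \<le> b \<and> Inf K = u \<and> Sup K = v"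
      if tK: "(t, K) \<in> p" for t K
    proof -
      obtain u v where uv: "K = {u..v}" using pD(4)[OF tK] by auto
      moreover have "t \<in> K" "K \<subseteq> {a..b}" using pD(2,3)[OF tK] by auto
      ultimately show ?thesis by (intro exI[of _ u] exI[of _ v]) auto
    qed
    define inc where "inc = (\<lambda>z::real \<times> real set. h (Sup (snd z)) - h (Inf (snd z)))"
    define len where "len = (\<lambda>z::real \<times> real set. Sup (snd z) - Inf (snd z))"
    have tot: "h b - h a = sum inc p"
      using additive_tagged_division_1[OF assms(1) p(1), of h]
      by (simp add: inc_def case_prod_unfold)
    have totlen: "b - a = sum len p"
      using additive_tagged_division_1[OF assms(1) p(1), of "\<lambda>t. t"]
      by (simp add: len_def case_prod_unfold)
    have len0: "0 \<le> len z" if "z \<in> p" for z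
      using K[of "fst z" "snd z"] that by (auto simp: len_def)
    have good: "inc z \<le> e * len z" if z: "z \<in> p - q" for z
    proof -
      obtain t K' where tK: "z = (t, K')" by (cases z)
      with z K[of t K'] obtain u v where uv: "K' = {u..v}" "u \<le> t" "t \<le> v" "a \<le> u" "v \<le> b"
        "Inf K' = u" "Sup K' = v" by auto
      show ?thesis
      proof (cases "u = v")
        case True
        then show ?thesis using uv tK by (simp add: inc_def len_def)
      next
        case False
        then have "t \<notin> N'" using z uv tK by (auto simp: q_def)
        then have t: "t \<in> {a<..<b} - N" using uv by (auto simp: N'_def)
        have "K' \<subseteq> \<gamma> t" using fineD[OF p(2)] z tK by auto
        then have "K' \<subseteq> ball t (r t)" using t by (simp add: \<gamma>_def)
        moreover have "u \<in> K'" "v \<in> K'" using uv(1-3) by auto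
        ultimately have "u \<in> ball t (r t)" "v \<in> ball t (r t)" by blast+
        then have "\<bar>u - t\<bar> < r t" "\<bar>v - t\<bar> < r t"
          by (simp_all add: dist_real_def abs_minus_commute)
        then have 1: "\<bar>h u - h t - (u - t) * h' t\<bar> \<le> e * \<bar>u - t\<bar>" "\<bar>h v - h t - (v - t) * h' t\<bar> \<le> e * \<bar>v - t\<bar>"
          using r(2)[OF t] by blast+
        have "h v - h u \<le> e * \<bar>u - t\<bar> + e * \<bar>v - t\<bar> + ((v - t) * h' t - (u - t) * h' t)"
          using 1 by linarith
        also have "(v - t) * h' t - (u - t) * h' t = (v - u) * h' t"
          by (simp add: algebra_simps)
        also have "\<dots> \<le> 0"
          using h'(2)[OF t] uv by (simp add: mult_nonneg_nonpos)
        also have "e * \<bar>u - t\<bar> + e * \<bar>v - t\<bar> + 0 = e * (v - u)"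
          using uv by (simp add: algebra_simps)
        finally show ?thesis using uv tK by (simp add: inc_def len_def)
      qed
    qed
    have qp: "q \<subseteq> p" by (auto simp: q_def)
    have finp: "finite p" using pD(1) .
    have finq: "finite q" using finite_subset[OF qp finp] .
    define I where "I = (\<lambda>z::real \<times> real set. (Inf (snd z), Sup (snd z)))"
    have disj: "{Inf (snd z)<..<Sup (snd z)} \<inter> {Inf (snd w)<..<Sup (snd w)} = {}"
      if "z \<in> q" "w \<in> q" "z \<noteq> w" for z w
    proof -
      obtain t S t' S' where zw: "z = (t, S)" "w = (t', S')" by (cases z, cases w)
      have "interior S \<inter> interior S' = {}"
        using pD(5)[of t S t' S'] that qp zw by auto
      moreover have "(t, S) \<in> p" "(t', S') \<in> p" using that qp zw by auto
      moreover obtain u v where "S = {u..v}" "Inf S = u" "Sup S = v"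
        using K[OF calculation(2)] by blast
      moreover obtain u' v' where "S' = {u'..v'}" "Inf S' = u'" "Sup S' = v'"
        using K[OF calculation(3)] by blast
      ultimately show ?thesis using zw by (simp add: interior_atLeastAtMost_real)
    qed
    have inj: "inj_on I q"
    proof (rule inj_onI, rule ccontr)
      fix z w assume zw: "z \<in> q" "w \<in> q" "I z = I w" "z \<noteq> w"
      then have "{Inf (snd z)<..<Sup (snd z)} = {}" using disj[of z w] by (auto simp: I_def)
      then show False using zw by (auto simp: q_def)
    qed
    have bad: "sum inc q < e"
    proof -
      have "sum inc q \<le> (\<Sum>z\<in>q. \<bar>h (Sup (snd z)) - h (Inf (snd z))\<bar>)"
        by (intro sum_mono) (auto simp: inc_def)
      also have "\<dots> = (\<Sum>(u, v)\<in>I ` q. norm (complex_of_real (h v) - complex_of_real (h u)))"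
        by (subst sum.reindex[OF inj]) (auto simp: I_def case_prod_unfold norm_of_real simp flip: of_real_diff)
      also have "\<dots> < e"
      proof (rule \<delta>(2), intro conjI)
        show "finite (I ` q)" using finq by simp
        show "\<forall>(u, v)\<in>I ` q. a \<le> u \<and> u < v \<and> v \<le> b"
        proof -
          have "a \<le> u \<and> u < v \<and> v \<le> b" if "(u, v) \<in> I ` q" for u v
          proof -
            from that obtain t S where "(t, S) \<in> q" "Inf S = u" "Sup S = v" by (auto simp: I_def)
            moreover from this have "(t, S) \<in> p" "u < v" by (auto simp: q_def)
            ultimately show ?thesis using K[of t S] by metis
          qed
          then show ?thesis by blast
        qed
        show "pairwise (\<lambda>(u, v) (u', v'). {u<..<v} \<inter> {u'<..<v'} = {}) (I ` q)"
          using disj by (fastforce simp: pairwise_def I_def)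
        have "(\<Sum>(u, v)\<in>I ` q. v - u) = (\<Sum>z\<in>q. len z)"
          by (subst sum.reindex[OF inj]) (auto simp: I_def len_def case_prod_unfold)
        also have "\<dots> = (\<Sum>z\<in>q. measure lborel (snd z))"
        proof (rule sum.cong)
          fix z assume "z \<in> q"
          then have "(fst z, snd z) \<in> p" using qp by auto
          from K[OF this] obtain u v where "snd z = {u..v}" "u \<le> v" "Inf (snd z) = u" "Sup (snd z) = v"
            using order_trans by blast
          then show "len z = measure lborel (snd z)" by (simp add: len_def)
        qed simp
        also have "\<dots> = sum (measure lborel) (snd ` q)"
        proof (rule sum.reindex_cong[symmetric])
          show "inj_on snd q" using inj unfolding inj_on_def I_def by auto
        qed auto
        also have "\<dots> \<le> measure lebesgue U"
        proof (rule sum_content_division_le_measure[OF _ _ Umeas(1)])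
          have "q tagged_partial_division_of {a..b}"
            using p(1) qp tagged_partial_division_subset unfolding tagged_division_of_def by blast
          then show "snd ` q division_of \<Union> (snd ` q)"
            by (rule partial_division_of_tagged_division)
          have "snd z \<subseteq> U" if "z \<in> q" for z
          proof -
            have "fst z \<in> N'" "z \<in> p" using that by (auto simp: q_def)
            moreover have "fst z \<notin> {a<..<b} - N" using calculation by (auto simp: N'_def)
            ultimately have "snd z \<subseteq> \<gamma> (fst z)" "\<gamma> (fst z) = U"
              using fineD[OF p(2), of "fst z" "snd z"] by (auto simp: \<gamma>_def)
            then show ?thesis by simp
          qed
          then show "\<Union> (snd ` q) \<subseteq> U" by auto
        qed
        also have "\<dots> < \<delta>" by (rule Umeas)
        finally show "(\<Sum>(u, v)\<in>I ` q. v - u) < \<delta>" .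
      qed
      finally show ?thesis .
    qed
    have "sum inc p = sum inc (p - q) + sum inc q"
      using sum.subset_diff[OF qp finp] by metis
    also have "\<dots> \<le> (\<Sum>z\<in>p - q. e * len z) + e"
      using bad good by (intro add_mono sum_mono) auto
    also have "(\<Sum>z\<in>p - q. e * len z) \<le> (\<Sum>z\<in>p. e * len z)"
      using finp len0 e by (intro sum_mono2) auto
    also have "\<dots> = e * (b - a)"
      by (simp add: totlen sum_distrib_left)
    finally show ?thesis using tot by (simp add: algebra_simps)
  qed
  show ?thesis
  proof (rule ccontr)
    assume "\<not> h b \<le> h a"
    then have pos: "h b - h a > 0" by simp
    define c where "c = b - a + 1"
    have c: "c > 0" using assms(1) by (simp add: c_def)
    define e where "e = (h b - h a) / (2 * c)"
    have "e > 0" using pos c by (simp add: e_def)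
    moreover have "e * c = (h b - h a) / 2" using c by (simp add: e_def)
    ultimately show False using main[of e] pos by (simp add: c_def)
  qed
qed

text \<open>
  Multiplying by the integrating factor \<open>exp (- \<integral> L)\<close> produces an absolutely continuous function
  with nonpositive derivative almost everywhere. The rate \<open>L\<close> may have any sign; the norm bound for
  solutions below uses it with a negative one.
\<close>

lemma abs_continuous_gronwall:
  fixes h h' L :: "real \<Rightarrow> real"
  assumes "a \<le> b" and ac: "abs_continuous_on_Icc a b (\<lambda>t. of_real (h t))"
    and L: "L absolutely_integrable_on {a..b}"
    and N: "negligible N"
    and h': "\<And>t. t \<in> {a<..<b} - N \<Longrightarrow> (h has_vector_derivative h' t) (at t)"
      "\<And>t. t \<in> {a<..<b} - N \<Longrightarrow> h' t \<le> L t * h t"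
  shows "h b \<le> h a * exp (integral {a..b} L)"
proof -
  define \<Lambda> where "\<Lambda> = (\<lambda>t. integral {a..t} L)"
  define k where "k = (\<lambda>t. h t * exp (- \<Lambda> t))"
  have Li: "L integrable_on {a..b}" using L unfolding absolutely_integrable_on_def by auto
  obtain N1 where N1: "negligible N1" "\<And>t. t \<in> {a<..<b} - N1 \<Longrightarrow> (\<Lambda> has_vector_derivative L t) (at t)"
    using integral_has_vector_derivative_ae[OF Li] unfolding \<Lambda>_def by metis
  have ac\<Lambda>: "abs_continuous_on_Icc a b (\<lambda>t. of_real (- \<Lambda> t))"
    using L by (rule abs_continuous_on_Icc_integral)
      (simp add: \<Lambda>_def norm_minus_commute flip: of_real_minus of_real_diff)
  have ack: "abs_continuous_on_Icc a b (\<lambda>t. of_real (k t))"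
    using abs_continuous_on_Icc_mult[OF ac abs_continuous_on_Icc_exp[OF ac\<Lambda>]]
    by (simp add: k_def exp_of_real flip: of_real_minus)
  have "k b \<le> k a"
  proof (rule abs_continuous_deriv_nonpos_imp_le[OF assms(1) ack])
    show "negligible (N \<union> N1)" using N N1 by simp
    fix t assume t: "t \<in> {a<..<b} - (N \<union> N1)"
    have d: "(h has_real_derivative h' t) (at t)" "(\<Lambda> has_real_derivative L t) (at t)"
      using h'(1)[of t] N1(2)[of t] t by (auto simp: has_real_derivative_iff_has_vector_derivative)
    show "(k has_vector_derivative (h' t - L t * h t) * exp (- \<Lambda> t)) (at t)"
      unfolding k_def has_real_derivative_iff_has_vector_derivative[symmetric]
      by (rule derivative_eq_intros d refl)+ (simp add: algebra_simps)
    show "(h' t - L t * h t) * exp (- \<Lambda> t) \<le> 0"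
      using h'(2)[of t] t by (simp add: mult_le_0_iff)
  qed
  then have "h b * exp (- \<Lambda> b) \<le> h a" by (simp add: k_def \<Lambda>_def)
  then have "h b * exp (- \<Lambda> b) * exp (\<Lambda> b) \<le> h a * exp (\<Lambda> b)" by (intro mult_right_mono) auto
  then show ?thesis by (simp add: \<Lambda>_def mult.assoc flip: exp_add)
qed

section \<open>Caratheodory differential equations with a global Lipschitz condition\<close>

text \<open>
  Along a step function the composition is a countable patchwork of the measurable functions
  \<open>H z\<close>; a continuous \<open>x\<close> is the pointwise limit of the step functions
  \<open>t \<mapsto> x (\<lfloor>n * t\<rfloor> / n)\<close>, and continuity of \<open>H\<close> in \<open>z\<close> transfers the limit.
\<close>

lemma borel_measurable_caratheodory_compose:
  fixes H :: "'a::metric_space \<Rightarrow> real \<Rightarrow> 'b::euclidean_space"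
  assumes meas: "\<And>z. H z \<in> borel_measurable (lebesgue_on {a..b})"
    and cont: "\<And>t. t \<in> {a..b} \<Longrightarrow> continuous_on UNIV (\<lambda>z. H z t)"
    and x: "continuous_on {a..b} x"
  shows "(\<lambda>t. H (x t) t) \<in> borel_measurable (lebesgue_on {a..b})"
proof (cases "a \<le> b")
  case False
  then show ?thesis by (simp add: measurable_def space_restrict_space)
next
  case ab: True
  define y where "y = (\<lambda>t. x (max a (min b t)))"
  have y: "continuous_on UNIV y"
    unfolding y_def using ab
    by (intro continuous_on_compose2[OF x]) (auto intro!: continuous_intros)
  define p where "p = (\<lambda>(n::nat) t::real. real_of_int \<lfloor>real (Suc n) * t\<rfloor> / real (Suc n))"
  show ?thesis
  proof (rule borel_measurable_LIMSEQ_metric)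
    fix n
    have "(\<lambda>t. real (Suc n) * t) \<in> borel_measurable (lebesgue_on {a..b})"
      by (intro continuous_imp_measurable_on_sets_lebesgue continuous_intros) auto
    then have "(\<lambda>t. \<lfloor>real (Suc n) * t\<rfloor>) \<in> measurable (lebesgue_on {a..b}) (count_space UNIV)"
      by (rule measurable_compose) measurable
    from measurable_compose_countable'[where f = "\<lambda>i. H (y (real_of_int i / real (Suc n)))", OF meas this]
    show "(\<lambda>t. H (y (p n t)) t) \<in> borel_measurable (lebesgue_on {a..b})"
      by (simp add: p_def)
  next
    fix t assume "t \<in> space (lebesgue_on {a..b})"
    then have t: "t \<in> {a..b}" by (simp add: space_restrict_space)
    have "(\<lambda>n. p n t) \<longlonglongrightarrow> t"
    proof (rule LIMSEQ_I)
      fix e :: real assume "0 < e"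
      then obtain n0 where n0: "inverse (real (Suc n0)) < e" using reals_Archimedean by blast
      show "\<exists>no. \<forall>n\<ge>no. norm (p n t - t) < e"
      proof (intro exI allI impI)
        fix n assume n: "n0 \<le> n"
        have "p n t - t = (real_of_int \<lfloor>real (Suc n) * t\<rfloor> - real (Suc n) * t) / real (Suc n)"
          by (simp add: p_def diff_divide_distrib)
        then have "norm (p n t - t) = \<bar>real_of_int \<lfloor>real (Suc n) * t\<rfloor> - real (Suc n) * t\<bar> / real (Suc n)"
          by simp
        also have "\<dots> \<le> 1 / real (Suc n)"
          by (intro divide_right_mono) (linarith | simp)+
        also have "\<dots> \<le> inverse (real (Suc n0))"
          using n by (simp add: field_simps)
        finally show "norm (p n t - t) < e" using n0 by simp
      qed
    qed
    then have "(\<lambda>n. y (p n t)) \<longlonglongrightarrow> y t"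
      using y by (intro continuous_on_tendsto_compose[OF y]) auto
    then have "(\<lambda>n. H (y (p n t)) t) \<longlonglongrightarrow> H (y t) t"
      by (intro continuous_on_tendsto_compose[OF cont[OF t]]) auto
    then show "(\<lambda>n. H (y (p n t)) t) \<longlonglongrightarrow> H (x t) t"
      using t by (simp add: y_def)
  qed
qed

text \<open>
  The integrand is almost everywhere the derivative of \<open>exp (2 * \<integral> L) / 2\<close>. This estimate is what
  makes the Picard operator contract by the factor \<open>1/2\<close> in the norm weighted by
  \<open>exp (- 2 * \<integral> L)\<close>.
\<close>

lemma integral_times_exp_integral_le:
  fixes L :: "real \<Rightarrow> real"
  assumes "a \<le> b" and L: "L integrable_on {a..b}" "\<And>t. t \<in> {a..b} \<Longrightarrow> 0 \<le> L t"
  shows "(\<lambda>t. L t * exp (2 * integral {a..t} L)) integrable_on {a..b}"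
    and "integral {a..b} (\<lambda>t. L t * exp (2 * integral {a..t} L)) \<le> exp (2 * integral {a..b} L) / 2"
proof -
  define \<Lambda> where "\<Lambda> = (\<lambda>t. integral {a..t} L)"
  define w where "w = (\<lambda>t. L t * exp (2 * \<Lambda> t))"
  define W where "W = (\<lambda>t. integral {a..t} w)"
  have Labs: "L absolutely_integrable_on {a..b}"
    using L by (intro nonnegative_absolutely_integrable_1) auto
  have c: "continuous_on {a..b} \<Lambda>"
    unfolding \<Lambda>_def by (rule indefinite_integral_continuous_1[OF L(1)])
  have E: "continuous_on {a..b} (\<lambda>t. exp (2 * \<Lambda> t))"
    by (intro continuous_intros c)
  have "(\<lambda>t. exp (2 * \<Lambda> t) * L t) absolutely_integrable_on {a..b}"
  proof (rule absolutely_integrable_bounded_measurable_product_real[OF _ _ _ Labs])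
    show "(\<lambda>t. exp (2 * \<Lambda> t)) \<in> borel_measurable (lebesgue_on {a..b})"
      by (rule continuous_imp_measurable_on_sets_lebesgue[OF E]) auto
    show "bounded ((\<lambda>t. exp (2 * \<Lambda> t)) ` {a..b})"
      by (intro compact_imp_bounded compact_continuous_image E) auto
  qed auto
  then have wabs: "w absolutely_integrable_on {a..b}" by (simp add: w_def mult.commute)
  then have wint: "w integrable_on {a..b}" unfolding absolutely_integrable_on_def by auto
  then show "(\<lambda>t. L t * exp (2 * integral {a..t} L)) integrable_on {a..b}"
    by (simp add: w_def \<Lambda>_def)
  obtain N1 where N1: "negligible N1" "\<And>t. t \<in> {a<..<b} - N1 \<Longrightarrow> (\<Lambda> has_vector_derivative L t) (at t)"
    using integral_has_vector_derivative_ae[OF L(1)] unfolding \<Lambda>_def by metis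
  obtain N2 where N2: "negligible N2" "\<And>t. t \<in> {a<..<b} - N2 \<Longrightarrow> (W has_vector_derivative w t) (at t)"
    using integral_has_vector_derivative_ae[OF wint] unfolding W_def by metis
  have ac\<Lambda>: "abs_continuous_on_Icc a b (\<lambda>t. of_real (\<Lambda> t))"
    using Labs by (rule abs_continuous_on_Icc_integral) (simp add: \<Lambda>_def flip: of_real_diff)
  have "complex_of_real (exp (2 * \<Lambda> t)) = exp (of_real (\<Lambda> t)) * exp (of_real (\<Lambda> t))" for t
    by (simp only: mult_2 exp_add of_real_mult exp_of_real)
  then have acE: "abs_continuous_on_Icc a b (\<lambda>t. of_real (exp (2 * \<Lambda> t)))"
    using abs_continuous_on_Icc_mult[OF abs_continuous_on_Icc_exp[OF ac\<Lambda>] abs_continuous_on_Icc_exp[OF ac\<Lambda>]]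
    by (simp only:)
  have acW: "abs_continuous_on_Icc a b (\<lambda>t. of_real (W t))"
    using wabs by (rule abs_continuous_on_Icc_integral) (simp add: W_def flip: of_real_diff)
  have ac: "abs_continuous_on_Icc a b (\<lambda>t. of_real (W t - exp (2 * \<Lambda> t) / 2))"
    using acW acE by (rule abs_continuous_on_Icc_controlled[where C = 1])
      (simp flip: of_real_diff)
  have "W b - exp (2 * \<Lambda> b) / 2 \<le> W a - exp (2 * \<Lambda> a) / 2"
  proof (rule abs_continuous_deriv_nonpos_imp_le[OF assms(1) ac, where h' = "\<lambda>_. 0"])
    show "negligible (N1 \<union> N2)" using N1 N2 by simp
    fix t assume t: "t \<in> {a<..<b} - (N1 \<union> N2)"
    have d: "(W has_real_derivative w t) (at t)" "(\<Lambda> has_real_derivative L t) (at t)"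
      using N2(2)[of t] N1(2)[of t] t by (auto simp: has_real_derivative_iff_has_vector_derivative)
    show "((\<lambda>t. W t - exp (2 * \<Lambda> t) / 2) has_vector_derivative 0) (at t)"
      unfolding has_real_derivative_iff_has_vector_derivative[symmetric]
      by (auto intro!: derivative_eq_intros d simp: w_def)
  qed simp
  also have "\<dots> \<le> 0" by (simp add: W_def \<Lambda>_def)
  finally show "integral {a..b} (\<lambda>t. L t * exp (2 * integral {a..t} L)) \<le> exp (2 * integral {a..b} L) / 2"
    by (simp add: W_def w_def \<Lambda>_def)
qed

text \<open>
  Picard iteration on the whole interval at once. Writing \<open>x = exp (2 * \<integral> L) * u\<close> turns the
  Picard operator into a contraction for the supremum norm of \<open>u\<close>, whatever the size of \<open>\<integral> L\<close>.
\<close>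

lemma caratheodory_integral_equation:
  fixes H :: "'a::euclidean_space \<Rightarrow> real \<Rightarrow> 'a"
  assumes ab: "a \<le> b"
    and meas: "\<And>z. H z \<in> borel_measurable (lebesgue_on {a..b})"
    and L: "L integrable_on {a..b}" "\<And>t. t \<in> {a..b} \<Longrightarrow> 0 \<le> L t"
    and lip: "\<And>z w t. t \<in> {a..b} \<Longrightarrow> norm (H z t - H w t) \<le> L t * norm (z - w)"
    and bound: "\<And>z t. t \<in> {a..b} \<Longrightarrow> norm (H z t) \<le> L t"
  obtains x where "(\<lambda>t. H (x t) t) absolutely_integrable_on {a..b}"
    "\<And>t. t \<in> {a..b} \<Longrightarrow> x t = z0 + integral {a..t} (\<lambda>s. H (x s) s)"
proof -
  define \<Lambda> where "\<Lambda> = (\<lambda>t. integral {a..t} L)"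
  define f where "f = (\<lambda>(u :: real \<Rightarrow>\<^sub>C 'a) t. H (exp (2 * \<Lambda> t) *\<^sub>R apply_bcontfun u t) t)"
  define J where "J = (\<lambda>u t. z0 + integral {a..t} (f u))"
  \<comment> \<open>Clamping time to \<open>[a, b]\<close> lets the operator act on bounded continuous functions on the whole line.\<close>
  define c where "c = (\<lambda>t. max a (min b t))"
  define \<Phi> where "\<Phi> = (\<lambda>u. Bcontfun (\<lambda>t. exp (- 2 * \<Lambda> (c t)) *\<^sub>R J u (c t)))"
  have \<Lambda>cont: "continuous_on {a..b} \<Lambda>"
    unfolding \<Lambda>_def by (rule indefinite_integral_continuous_1[OF L(1)])
  have Hcont: "continuous_on UNIV (\<lambda>z. H z t)" if "t \<in> {a..b}" for t
  proof -
    have "(L t)-lipschitz_on UNIV (\<lambda>z. H z t)"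
      using lip[OF that] L(2)[OF that] by (auto simp: lipschitz_on_def dist_norm)
    then show ?thesis by (rule lipschitz_on_continuous_on)
  qed
  have fabs: "f u absolutely_integrable_on {a..b}" for u
    unfolding f_def
  proof (rule measurable_bounded_by_integrable_imp_absolutely_integrable[OF _ _ L(1)])
    show "(\<lambda>t. H (exp (2 * \<Lambda> t) *\<^sub>R apply_bcontfun u t) t) \<in> borel_measurable (lebesgue_on {a..b})"
      by (rule borel_measurable_caratheodory_compose[OF meas Hcont])
        (auto intro!: continuous_intros \<Lambda>cont)
  qed (use bound in auto)
  have fint: "f u integrable_on {a..t}" if "t \<le> b" for u t
    using fabs[of u] that unfolding absolutely_integrable_on_def
    by (auto intro: integrable_on_subinterval)
  have c: "continuous_on UNIV c" "c t \<in> {a..b}" "t \<in> {a..b} \<Longrightarrow> c t = t" for t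
    unfolding c_def using ab by (auto intro!: continuous_intros)
  have \<Phi>: "apply_bcontfun (\<Phi> u) t = exp (- 2 * \<Lambda> (c t)) *\<^sub>R J u (c t)" for u :: "real \<Rightarrow>\<^sub>C 'a" and t
  proof -
    let ?g = "\<lambda>t. exp (- 2 * \<Lambda> t) *\<^sub>R J u t"
    have g: "continuous_on {a..b} ?g"
      unfolding J_def by (intro continuous_intros \<Lambda>cont indefinite_integral_continuous_1 fint) simp
    have "continuous_on UNIV (\<lambda>t. ?g (c t))"
      using c by (intro continuous_on_compose2[OF g c(1)]) auto
    moreover have "bounded (range (\<lambda>t. ?g (c t)))"
    proof (rule bounded_subset)
      show "bounded (?g ` {a..b})"
        by (intro compact_imp_bounded compact_continuous_image g) auto
    qed (use c(2) in blast)
    ultimately show ?thesis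
      unfolding \<Phi>_def by (subst Bcontfun_inverse) (auto simp: bcontfun_def)
  qed
  have "\<exists>!u. \<Phi> u = u"
  proof (rule banach_fix_type)
    show "\<forall>u v. dist (\<Phi> u) (\<Phi> v) \<le> 1/2 * dist u v"
    proof (intro allI dist_bound)
      fix u v :: "real \<Rightarrow>\<^sub>C 'a" and t0 :: real
      define t where "t = c t0"
      define D where "D = dist u v"
      have t: "t \<in> {a..b}" using c(2) by (simp add: t_def)
      have Lt: "L integrable_on {a..t}" "\<And>s. s \<in> {a..t} \<Longrightarrow> 0 \<le> L s"
        using L t by (auto intro: integrable_on_subinterval)
      have wt: "(\<lambda>s. L s * exp (2 * \<Lambda> s)) integrable_on {a..t}"
        "integral {a..t} (\<lambda>s. L s * exp (2 * \<Lambda> s)) \<le> exp (2 * \<Lambda> t) / 2"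
        using integral_times_exp_integral_le[OF _ Lt] t by (simp_all add: \<Lambda>_def)
      have "norm (J u t - J v t) = norm (integral {a..t} (\<lambda>s. f u s - f v s))"
        using t fint by (simp add: J_def integral_diff)
      also have "\<dots> \<le> integral {a..t} (\<lambda>s. D * (L s * exp (2 * \<Lambda> s)))"
      proof (rule integral_norm_bound_integral)
        show "(\<lambda>s. f u s - f v s) integrable_on {a..t}"
          using t by (intro integrable_diff fint) auto
        show "(\<lambda>s. D * (L s * exp (2 * \<Lambda> s))) integrable_on {a..t}"
          using wt(1) t by (intro integrable_on_mult_right) auto
        fix s assume "s \<in> {a..t}"
        then have s: "s \<in> {a..b}" using t by auto
        have "norm (f u s - f v s)
            \<le> L s * norm (exp (2 * \<Lambda> s) *\<^sub>R apply_bcontfun u s - exp (2 * \<Lambda> s) *\<^sub>R apply_bcontfun v s)"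
          unfolding f_def by (rule lip[OF s])
        also have "\<dots> = L s * (exp (2 * \<Lambda> s) * dist (apply_bcontfun u s) (apply_bcontfun v s))"
          by (simp add: dist_norm flip: scaleR_diff_right)
        also have "\<dots> \<le> L s * (exp (2 * \<Lambda> s) * D)"
          unfolding D_def using L(2)[OF s] by (intro mult_left_mono dist_bounded) auto
        finally show "norm (f u s - f v s) \<le> D * (L s * exp (2 * \<Lambda> s))"
          by (simp add: mult_ac)
      qed
      also have "\<dots> = D * integral {a..t} (\<lambda>s. L s * exp (2 * \<Lambda> s))" by simp
      also have "\<dots> \<le> D * (exp (2 * \<Lambda> t) / 2)"
        using wt(2) t by (intro mult_left_mono) (auto simp: D_def)
      finally have 1: "norm (J u t - J v t) \<le> D * (exp (2 * \<Lambda> t) / 2)" .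
      have "dist (apply_bcontfun (\<Phi> u) t0) (apply_bcontfun (\<Phi> v) t0) = exp (- 2 * \<Lambda> t) * norm (J u t - J v t)"
        by (simp add: \<Phi> t_def dist_norm flip: scaleR_diff_right)
      also have "\<dots> \<le> exp (- 2 * \<Lambda> t) * (D * (exp (2 * \<Lambda> t) / 2))"
        using 1 by (intro mult_left_mono) auto
      also have "\<dots> = 1/2 * D" by (simp add: exp_minus field_simps)
      finally show "dist (apply_bcontfun (\<Phi> u) t0) (apply_bcontfun (\<Phi> v) t0) \<le> 1/2 * dist u v"
        by (simp add: D_def)
    qed
  qed auto
  then obtain u where u: "\<Phi> u = u" by blast
  define x where "x = (\<lambda>t. exp (2 * \<Lambda> t) *\<^sub>R apply_bcontfun u t)"
  have fx: "f u = (\<lambda>t. H (x t) t)" by (simp add: f_def x_def)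
  show ?thesis
  proof (rule that)
    show "(\<lambda>t. H (x t) t) absolutely_integrable_on {a..b}" using fabs[of u] fx by simp
    fix t assume t: "t \<in> {a..b}"
    have "apply_bcontfun u t = exp (- 2 * \<Lambda> t) *\<^sub>R J u t"
      using \<Phi>[of u t] u c(3)[OF t] by simp
    then show "x t = z0 + integral {a..t} (\<lambda>s. H (x s) s)"
      by (simp add: x_def J_def fx flip: exp_add)
  qed
qed

lemma caratheodory_existence:
  fixes H :: "complex \<Rightarrow> real \<Rightarrow> complex"
  assumes ab: "a \<le> b"
    and meas: "\<And>z. H z \<in> borel_measurable (lebesgue_on {a..b})"
    and L: "L integrable_on {a..b}" "\<And>t. t \<in> {a..b} \<Longrightarrow> 0 \<le> L t"
    and lip: "\<And>z w t. t \<in> {a..b} \<Longrightarrow> norm (H z t - H w t) \<le> L t * norm (z - w)"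
    and bound: "\<And>z t. t \<in> {a..b} \<Longrightarrow> norm (H z t) \<le> L t"
  obtains x N where "abs_continuous_on_Icc a b x" "x a = z0" "negligible N"
    "\<And>t. t \<in> {a<..<b} - N \<Longrightarrow> (x has_vector_derivative H (x t) t) (at t)"
proof -
  obtain x where x: "(\<lambda>t. H (x t) t) absolutely_integrable_on {a..b}"
    "\<And>t. t \<in> {a..b} \<Longrightarrow> x t = z0 + integral {a..t} (\<lambda>s. H (x s) s)"
    using caratheodory_integral_equation[OF assms] by metis
  have int: "(\<lambda>t. H (x t) t) integrable_on {a..b}"
    using x(1) unfolding absolutely_integrable_on_def by auto
  obtain N where N: "negligible N" "\<And>t. t \<in> {a<..<b} - N \<Longrightarrow>
      ((\<lambda>t. integral {a..t} (\<lambda>s. H (x s) s)) has_vector_derivative H (x t) t) (at t)"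
    using integral_has_vector_derivative_ae[OF int] by metis
  show ?thesis
  proof (rule that[OF _ _ N(1)])
    show "abs_continuous_on_Icc a b x"
      using x by (intro abs_continuous_on_Icc_integral[OF x(1)]) auto
    show "x a = z0" using x(2)[of a] ab by simp
    fix t assume t: "t \<in> {a<..<b} - N"
    have "((\<lambda>t. z0 + integral {a..t} (\<lambda>s. H (x s) s)) has_vector_derivative 0 + H (x t) t) (at t)"
      by (intro has_vector_derivative_add N(2) t has_vector_derivative_const)
    then show "(x has_vector_derivative H (x t) t) (at t)"
      using has_vector_derivative_transform_within_open[of _ _ t "{a<..<b}" x] x(2) t by auto
  qed
qed

lemma abs_continuous_on_Icc_norm_diff_sq:
  assumes "abs_continuous_on_Icc a b x" "abs_continuous_on_Icc a b y"
  shows "abs_continuous_on_Icc a b (\<lambda>t. of_real ((norm (x t - y t))\<^sup>2))"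
proof -
  have d: "abs_continuous_on_Icc a b (\<lambda>t. x t - y t)"
  proof (rule abs_continuous_on_Icc_controlled[OF assms, where C = 1])
    fix u v
    have "x v - y v - (x u - y u) = (x v - x u) - (y v - y u)" by simp
    then show "norm (x v - y v - (x u - y u)) \<le> 1 * (norm (x v - x u) + norm (y v - y u))"
      by (metis mult_1 norm_triangle_ineq4)
  qed
  have "abs_continuous_on_Icc a b (\<lambda>t. cnj (x t - y t))"
    using d d by (rule abs_continuous_on_Icc_controlled[where C = 1])
      (simp flip: complex_cnj_diff)
  from abs_continuous_on_Icc_mult[OF d this] show ?thesis
    by (simp only: complex_norm_square)
qed

text \<open>
  Gronwall's inequality for the squared distance, which is differentiable wherever both functions
  are.
\<close>

lemma caratheodory_uniqueness:
  assumes ab: "a \<le> b"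
    and ac: "abs_continuous_on_Icc a b x" "abs_continuous_on_Icc a b y"
    and init: "x a = y a"
    and L: "L absolutely_integrable_on {a..b}"
    and N: "negligible N"
    and dx: "\<And>t. t \<in> {a<..<b} - N \<Longrightarrow> (x has_vector_derivative x' t) (at t)"
    and dy: "\<And>t. t \<in> {a<..<b} - N \<Longrightarrow> (y has_vector_derivative y' t) (at t)"
    and lip: "\<And>t. t \<in> {a<..<b} - N \<Longrightarrow> norm (x' t - y' t) \<le> L t * norm (x t - y t)"
  shows "x b = y b"
proof -
  define h where "h = (\<lambda>t. (norm (x t - y t))\<^sup>2)"
  have "h b \<le> h a * exp (integral {a..b} (\<lambda>t. 2 * L t))"
  proof (rule abs_continuous_gronwall[OF ab _ _ N,
        where h' = "\<lambda>t. 2 * ((x t - y t) \<bullet> (x' t - y' t))"])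
    show "abs_continuous_on_Icc a b (\<lambda>t. of_real (h t))"
      unfolding h_def by (rule abs_continuous_on_Icc_norm_diff_sq[OF ac])
    show "(\<lambda>t. 2 * L t) absolutely_integrable_on {a..b}"
      using L by (intro set_integrable_mult_right) auto
    fix t assume t: "t \<in> {a<..<b} - N"
    have d: "((\<lambda>t. x t - y t) has_vector_derivative x' t - y' t) (at t)"
      by (intro has_vector_derivative_diff dx dy t)
    show "(h has_vector_derivative 2 * ((x t - y t) \<bullet> (x' t - y' t))) (at t)"
      using bounded_bilinear.has_vector_derivative[OF bounded_bilinear_inner d d]
      by (simp add: h_def power2_norm_eq_inner inner_commute)
    have "(x t - y t) \<bullet> (x' t - y' t) \<le> norm (x t - y t) * norm (x' t - y' t)"
      by (rule norm_cauchy_schwarz)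
    also have "\<dots> \<le> norm (x t - y t) * (L t * norm (x t - y t))"
      by (intro mult_left_mono lip t) auto
    finally show "2 * ((x t - y t) \<bullet> (x' t - y' t)) \<le> 2 * L t * h t"
      by (simp add: h_def power2_eq_square mult_ac)
  qed
  then have "h b \<le> 0" by (simp add: h_def init)
  then show ?thesis by (simp add: h_def)
qed

section \<open>Infinitesimal generators on the disc\<close>

text \<open>
  The Schwarz lemma for \<open>f\<close> followed by the disc automorphism that moves \<open>f 0\<close> to the origin. For
  \<open>f = id\<close> both sides agree, which is why the inequality can be differentiated along a semigroup at
  time \<open>0\<close>.
\<close>

lemma Schwarz_Pick_origin:
  assumes holf: "f holomorphic_on ball 0 1" and self: "f ` ball 0 1 \<subseteq> ball 0 1"
    and z: "z \<in> ball (0::complex) 1"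
  shows "norm (f z - f 0) \<le> norm z * norm (1 - cnj (f 0) * f z)"
proof -
  define M where "M = Moebius_function 0 (f 0)"
  have f1: "norm (f w) < 1" if "norm w < 1" for w
    using self that by (auto simp: image_subset_iff)
  have f0: "norm (f 0) < 1" using f1 by simp
  have "M holomorphic_on ball 0 1"
    unfolding M_def using f0 by (rule Moebius_function_holomorphic)
  then have holM: "(M \<circ> f) holomorphic_on ball 0 1"
    using holf self by (intro holomorphic_on_compose_gen) auto
  have M0: "(M \<circ> f) 0 = 0" by (simp add: M_def Moebius_function_eq_zero)
  have M1: "norm ((M \<circ> f) w) < 1" if "norm w < 1" for w
    using f0 f1[OF that] by (simp add: M_def Moebius_function_norm_lt_1)
  have "norm ((M \<circ> f) z) \<le> norm z"
    using Schwarz_Lemma(1)[OF holM M0 M1] z by simp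
  then have le: "norm ((f z - f 0) / (1 - cnj (f 0) * f z)) \<le> norm z"
    by (simp add: M_def Moebius_function_simple)
  have "norm (cnj (f 0) * f z) < 1"
    using f0 f1[of z] z norm_mult_less[of "cnj (f 0)" 1 "f z" 1] by simp
  then have "1 - cnj (f 0) * f z \<noteq> 0" by auto
  then show ?thesis
    using le by (simp add: norm_divide divide_le_eq)
qed

text \<open>
  The one consequence of being a generator that the argument rests on: the radial component of
  \<open>F\<close> pointing outwards vanishes at the boundary at least as fast as \<open>1 - \<bar>z\<bar>\<^sup>2\<close>, at a rate controlled by
  the single value \<open>F 0\<close>. The Schwarz-Pick inequality for \<open>\<phi> t\<close> is an equality at \<open>t = 0\<close>, so the
  derivative at \<open>0\<close> of left minus right side (both squared) is nonpositive, and this derivative is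
  \<open>2 * (z \<bullet> F z - (z \<bullet> F 0) * (1 - \<bar>z\<bar>\<^sup>2))\<close>.
\<close>

lemma generator_radial_bound:
  assumes F: "F \<in> Gen_disc" and z: "z \<in> unit_disc"
  shows "z \<bullet> F z \<le> norm (F 0) * (1 - (norm z)\<^sup>2)"
proof -
  obtain \<phi> where sg: "holomorphic_semigroup \<phi>" and gen: "is_generator_of F \<phi>"
    using F unfolding Gen_disc_def by auto
  define p where "p = (\<lambda>t. \<phi> t z)"
  define q where "q = (\<lambda>t. \<phi> t 0)"
  have init: "p 0 = z" "q 0 = 0"
    using sg z unfolding holomorphic_semigroup_def p_def q_def by auto
  have dp: "(p has_vector_derivative F z) (at 0 within {0..})"
    and dq: "(q has_vector_derivative F 0) (at 0 within {0..})"
  proof -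
    have "((\<lambda>r. \<phi> r w) has_vector_derivative F (\<phi> 0 w)) (at 0 within {0..})" if "w \<in> unit_disc" for w
      using gen that unfolding is_generator_of_def by simp
    from this[of z] this[of 0]
    show "(p has_vector_derivative F z) (at 0 within {0..})"
      "(q has_vector_derivative F 0) (at 0 within {0..})"
      using z init by (simp_all add: p_def q_def)
  qed
  define h where "h = (\<lambda>t. (p t - q t) \<bullet> (p t - q t)
      - (norm z)\<^sup>2 * ((1 - cnj (q t) * p t) \<bullet> (1 - cnj (q t) * p t)))"
  have h_le: "h t \<le> 0" if "t \<ge> 0" for t
  proof -
    have "norm (p t - q t) \<le> norm z * norm (1 - cnj (q t) * p t)"
      using Schwarz_Pick_origin[of "\<phi> t" z] sg z that
      unfolding holomorphic_semigroup_def p_def q_def by auto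
    then have "(norm (p t - q t))\<^sup>2 \<le> (norm z * norm (1 - cnj (q t) * p t))\<^sup>2"
      by (intro power_mono) auto
    then show ?thesis by (simp add: h_def power2_norm_eq_inner[symmetric] power_mult_distrib)
  qed
  have h0: "h 0 = 0" by (simp add: h_def init power2_norm_eq_inner)
  define D where "D = 2 * (z \<bullet> (F z - F 0)) + (norm z)\<^sup>2 * (2 * (z \<bullet> F 0))"
  have "(h has_vector_derivative D) (at 0 within {0..})"
  proof -
    have d1: "((\<lambda>t. p t - q t) has_vector_derivative F z - F 0) (at 0 within {0..})"
      by (intro has_vector_derivative_diff dp dq)
    have dc: "((\<lambda>t. cnj (q t)) has_vector_derivative cnj (F 0)) (at 0 within {0..})"
      using bounded_linear.has_vector_derivative[OF bounded_linear_cnj dq] by simp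
    have "((\<lambda>t. cnj (q t) * p t) has_vector_derivative cnj (q 0) * F z + cnj (F 0) * p 0) (at 0 within {0..})"
      by (rule has_vector_derivative_mult[OF dc dp])
    then have d2: "((\<lambda>t. 1 - cnj (q t) * p t) has_vector_derivative 0 - cnj (F 0) * z) (at 0 within {0..})"
      by (intro has_vector_derivative_diff has_vector_derivative_const) (simp add: init)
    note e1 = bounded_bilinear.has_vector_derivative[OF bounded_bilinear_inner d1 d1]
    note e2 = bounded_bilinear.has_vector_derivative[OF bounded_bilinear_inner d2 d2]
    note e3 = has_vector_derivative_mult_right[OF e2, of "(norm z)\<^sup>2"]
    have D: "D = ((p 0 - q 0) \<bullet> (F z - F 0) + (F z - F 0) \<bullet> (p 0 - q 0))
        - (norm z)\<^sup>2 * ((1 - cnj (q 0) * p 0) \<bullet> (0 - cnj (F 0) * z) + (0 - cnj (F 0) * z) \<bullet> (1 - cnj (q 0) * p 0))"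
      by (simp add: init D_def inner_commute inner_complex_def algebra_simps)
    show ?thesis
      unfolding D h_def by (rule has_vector_derivative_diff[OF e1 e3])
  qed
  then have hD: "(h has_real_derivative D) (at 0 within {0..})"
    by (simp add: has_real_derivative_iff_has_vector_derivative)
  have "D \<le> 0"
  proof (rule ccontr)
    assume "\<not> D \<le> 0"
    then obtain d where d: "d > 0" "\<And>k. k > 0 \<Longrightarrow> k < d \<Longrightarrow> h 0 < h (0 + k)"
      using has_real_derivative_pos_inc_right[OF hD] by auto
    show False using d(2)[of "d / 2"] d(1) h_le[of "d / 2"] h0 by simp
  qed
  then have "z \<bullet> F z \<le> (z \<bullet> F 0) * (1 - (norm z)\<^sup>2)"
    by (simp add: D_def inner_diff_right algebra_simps)
  also have "\<dots> \<le> norm (F 0) * (1 - (norm z)\<^sup>2)"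
  proof (rule mult_right_mono)
    have z1: "norm z < 1" using z by simp
    have "z \<bullet> F 0 \<le> norm z * norm (F 0)" by (rule norm_cauchy_schwarz)
    also have "\<dots> \<le> 1 * norm (F 0)" using z1 by (intro mult_right_mono) auto
    finally show "z \<bullet> F 0 \<le> norm (F 0)" by simp
    show "0 \<le> 1 - (norm z)\<^sup>2" using z1 by (simp add: power_le_one)
  qed
  finally show ?thesis .
qed

text \<open>
  Cauchy's estimate bounds the derivative on the smaller disc. It is the reason why a mere growth
  bound on a holomorphic vector field already yields the local Lipschitz condition of
  Caratheodory's theory.
\<close>

lemma holomorphic_bounded_imp_Lipschitz:
  assumes holf: "f holomorphic_on A" and A: "cball 0 S \<subseteq> A"
    and RS: "R < S"
    and bound: "\<And>z. z \<in> cball 0 S \<Longrightarrow> norm (f z) \<le> k"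
    and zw: "z \<in> cball 0 R" "w \<in> cball 0 R"
  shows "norm (f z - f w) \<le> k / (S - R) * norm (z - w)"
proof (rule field_differentiable_bound[OF _ _ _ zw(1) zw(2)])
  fix u :: complex assume u: "u \<in> cball 0 R"
  have cb: "cball u (S - R) \<subseteq> cball 0 S"
    using u by (simp add: cball_subset_cball_iff)
  have b: "ball u (S - R) \<subseteq> ball 0 S"
    using u by (simp add: ball_subset_ball_iff)
  have holS: "f holomorphic_on ball 0 S"
    using holf A ball_subset_cball by (blast intro: holomorphic_on_subset)
  have "u \<in> ball 0 S" using u RS by auto
  then show "(f has_field_derivative deriv f u) (at u within cball 0 R)"
    using holomorphic_derivI[OF holS] by (simp add: has_field_derivative_at_within)
  have "norm ((deriv ^^ 1) f u) \<le> fact 1 * k / (S - R) ^ 1"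
  proof (rule Cauchy_inequality)
    show "f holomorphic_on ball u (S - R)" using holS b by (rule holomorphic_on_subset)
    show "continuous_on (cball u (S - R)) f"
      using holf A cb by (meson continuous_on_subset holomorphic_on_imp_continuous_on order_trans)
    fix x assume "norm (u - x) = S - R"
    then have "x \<in> cball u (S - R)" by (simp add: dist_norm)
    then show "norm (f x) \<le> k" using cb bound by blast
  qed (use RS in auto)
  then show "norm (deriv f u) \<le> k / (S - R)" by simp
qed auto

section \<open>Herglotz vector fields and their solutions on compact intervals\<close>

lemma AE_lebesgue_on_iff_negligible:
  assumes "S \<in> sets lebesgue"
  shows "(AE t in lebesgue_on S. P t) \<longleftrightarrow> negligible {t \<in> S. \<not> P t}"
proof -
  have "(AE t in lebesgue_on S. P t) \<longleftrightarrow> (AE t in lebesgue. t \<in> S \<longrightarrow> P t)"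
    using assms by (simp add: AE_restrict_space_iff)
  also have "\<dots> \<longleftrightarrow> negligible {t \<in> S. \<not> P t}"
  proof
    assume "AE t in lebesgue. t \<in> S \<longrightarrow> P t"
    then obtain N where "N \<in> null_sets lebesgue" "{t \<in> space lebesgue. \<not> (t \<in> S \<longrightarrow> P t)} \<subseteq> N"
      unfolding eventually_ae_filter by blast
    then have "negligible N" "{t \<in> S. \<not> P t} \<subseteq> N"
      by (auto simp: negligible_iff_null_sets)
    then show "negligible {t \<in> S. \<not> P t}" by (rule negligible_subset)
  next
    assume "negligible {t \<in> S. \<not> P t}"
    then show "AE t in lebesgue. t \<in> S \<longrightarrow> P t"
      by (intro AE_I'[of "{t \<in> S. \<not> P t}"]) (auto simp: negligible_iff_null_sets)
  qed
  finally show ?thesis .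
qed

text \<open>
  One integrable function serves as bound and as Lipschitz constant on \<open>cball 0 R\<close>, off one null set
  of times. The bound is first obtained for the points of a countable dense set, where the null sets
  can be united, and extends by continuity in \<open>z\<close>.
\<close>

lemma Herglotz_vector_field_local_bounds:
  assumes d: "1 \<le> d" and G: "Herglotz_vector_field d G" and R: "0 \<le> R" "R < 1" and T: "0 < T"
  obtains L N where "L integrable_on {0..T}" "\<And>t. t \<in> {0..T} \<Longrightarrow> 0 \<le> L t" "negligible N"
    "\<And>t. t \<in> {0..T} - N \<Longrightarrow> (\<lambda>z. G z t) \<in> Gen_disc"
    "\<And>t z. t \<in> {0..T} - N \<Longrightarrow> z \<in> cball 0 R \<Longrightarrow> norm (G z t) \<le> L t"
    "\<And>t z w. t \<in> {0..T} - N \<Longrightarrow> z \<in> cball 0 R \<Longrightarrow> w \<in> cball 0 R \<Longrightarrow>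
       norm (G z t - G w t) \<le> L t * norm (z - w)"
proof -
  \<comment> \<open>Bounds on the slightly larger disc of radius \<open>S\<close> give Lipschitz constants on that of radius \<open>R\<close>.\<close>
  define S where "S = (1 + R) / 2"
  have S: "R < S" "S < 1" using R by (auto simp: S_def)
  define K where "K = cball (0::complex) S"
  have K: "compact K" "K \<subseteq> unit_disc" using S by (auto simp: K_def)
  obtain k where k: "\<And>t. t \<in> {0..T} \<Longrightarrow> 0 \<le> k t" "k \<in> borel_measurable (lebesgue_on {0..T})"
    "integrable (lebesgue_on {0..T}) (\<lambda>t. k t powr d)"
    "\<And>z. z \<in> K \<Longrightarrow> AE t in lebesgue_on {0..T}. norm (G z t) \<le> k t"
    using G K T unfolding Herglotz_vector_field_def weak_holomorphic_vector_field_def by meson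
  have hol: "(\<lambda>z. G z t) holomorphic_on unit_disc" if "t \<ge> 0" for t
    using G that unfolding Herglotz_vector_field_def weak_holomorphic_vector_field_def by blast
  have kint: "k integrable_on {0..T}"
  proof -
    have "integrable (lebesgue_on {0..T}) (\<lambda>t. 1 + k t powr d)"
      using k(3) by (intro Bochner_Integration.integrable_add) (auto intro: finite_measure.integrable_const simp: finite_measure_lebesgue_on)
    then have "integrable (lebesgue_on {0..T}) k"
    proof (rule Bochner_Integration.integrable_bound[OF _ k(2)], intro AE_I2)
      fix t assume "t \<in> space (lebesgue_on {0..T})"
      then have kt: "0 \<le> k t" using k(1) by (simp add: space_restrict_space)
      have "k t \<le> 1 + k t powr d"
      proof (cases "k t \<le> 1")
        case True
        then show ?thesis using powr_ge_zero[of "k t" d] by linarith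
      next
        case False
        then have "k t powr 1 \<le> k t powr d" using d by (intro powr_mono) auto
        then show ?thesis using False by simp
      qed
      then show "norm (k t) \<le> norm (1 + k t powr d)" using kt by simp
    qed
    then show ?thesis by (rule integrable_on_lebesgue_on) auto
  qed
  obtain D where D: "countable D" "D \<subseteq> K" "K \<subseteq> closure D"
    using separable by metis
  define N1 where "N1 = {t \<in> {0..T}. \<not> (\<forall>z\<in>D. norm (G z t) \<le> k t)}"
  have "AE t in lebesgue_on {0..T}. \<forall>z\<in>D. norm (G z t) \<le> k t"
    using D k(4) by (intro AE_ball_countable') auto
  then have N1: "negligible N1"
    unfolding N1_def by (subst (asm) AE_lebesgue_on_iff_negligible) auto
  define N2 where "N2 = {t \<in> {0..}. (\<lambda>z. G z t) \<notin> Gen_disc}"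
  have "AE t in lebesgue_on {0..}. (\<lambda>z. G z t) \<in> Gen_disc"
    using G unfolding Herglotz_vector_field_def by blast
  then have N2: "negligible N2"
    unfolding N2_def by (subst (asm) AE_lebesgue_on_iff_negligible) auto
  define C where "C = 1 + 1 / (S - R)"
  have C: "1 \<le> C" "1 / (S - R) \<le> C" using S by (auto simp: C_def)
  have bound: "norm (G z t) \<le> k t" if "t \<in> {0..T} - (N1 \<union> N2)" "z \<in> K" for t z
  proof (rule continuous_on_closure_norm_le[where f = "\<lambda>z. G z t" and s = D and x = z])
    have "closure D \<subseteq> unit_disc"
      using D(2) K closure_minimal[of D K] compact_imp_closed[of K] by blast
    moreover have "continuous_on unit_disc (\<lambda>z. G z t)"
      using hol[of t] that(1) by (intro holomorphic_on_imp_continuous_on) auto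
    ultimately show "continuous_on (closure D) (\<lambda>z. G z t)"
      by (rule continuous_on_subset[rotated])
    show "\<forall>z\<in>D. norm (G z t) \<le> k t" using that by (auto simp: N1_def)
    show "z \<in> closure D" using that D(3) by blast
  qed
  show ?thesis
  proof (rule that[of "\<lambda>t. C * k t" "N1 \<union> N2"])
    show "(\<lambda>t. C * k t) integrable_on {0..T}" using kint by (rule integrable_on_mult_right)
    show "0 \<le> C * k t" if "t \<in> {0..T}" for t using k(1)[OF that] C by simp
    show "negligible (N1 \<union> N2)" using N1 N2 by simp
    fix t assume t: "t \<in> {0..T} - (N1 \<union> N2)"
    have kt: "0 \<le> k t" using k(1) t by blast
    show "(\<lambda>z. G z t) \<in> Gen_disc" using t by (auto simp: N2_def)
    fix z :: complex assume z: "z \<in> cball 0 R"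
    then have "z \<in> K" using S by (auto simp: K_def)
    then have "norm (G z t) \<le> k t" using bound t by blast
    also have "\<dots> \<le> C * k t" using C kt by (simp add: mult_right_mono[of 1 C "k t", simplified])
    finally show "norm (G z t) \<le> C * k t" .
    fix w :: complex assume w: "w \<in> cball 0 R"
    have "norm (G z t - G w t) \<le> k t / (S - R) * norm (z - w)"
      using holomorphic_bounded_imp_Lipschitz[OF hol[of t] _ S(1) _ z w, of "k t"] K bound[OF t] t
      by (auto simp: K_def)
    also have "\<dots> \<le> C * k t * norm (z - w)"
      using mult_right_mono[OF C(2) kt] by (intro mult_right_mono) (auto simp: mult.commute)
    finally show "norm (G z t - G w t) \<le> C * k t * norm (z - w)" .
  qed
qed

text \<open>
  Solutions on a closed interval, with the null set of exceptional times made explicit so that null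
  sets from different sources can be united. The derivative is asked for in the open interval only,
  where it is two-sided.
\<close>

definition solves_on :: "(complex \<Rightarrow> real \<Rightarrow> complex) \<Rightarrow> real \<Rightarrow> real \<Rightarrow> (real \<Rightarrow> complex) \<Rightarrow> bool" where
  "solves_on G a b x \<longleftrightarrow>
     abs_continuous_on_Icc a b x \<and> x ` {a..b} \<subseteq> unit_disc \<and>
     (\<exists>N. negligible N \<and> (\<forall>t\<in>{a<..<b} - N. (x has_vector_derivative G (x t) t) (at t)))"

lemma solves_on_subset:
  assumes "solves_on G a b x" "b' \<le> b"
  shows "solves_on G a b' x"
proof -
  obtain N where N: "negligible N" "\<And>t. t \<in> {a<..<b} - N \<Longrightarrow> (x has_vector_derivative G (x t) t) (at t)"
    using assms(1) unfolding solves_on_def by blast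
  have "abs_continuous_on_Icc a b' x"
    using assms abs_continuous_on_Icc_subset[of a b x a b'] unfolding solves_on_def by auto
  moreover have "x ` {a..b'} \<subseteq> unit_disc"
    using assms unfolding solves_on_def by force
  moreover have "\<forall>t\<in>{a<..<b'} - N. (x has_vector_derivative G (x t) t) (at t)"
    using N(2) assms(2) by auto
  ultimately show ?thesis using N(1) unfolding solves_on_def by blast
qed

text \<open>
  By the radial bound for generators, \<open>h = \<bar>x\<bar>\<^sup>2 - 1\<close> satisfies \<open>h' \<le> - 2 * g * h\<close> almost
  everywhere, and Gronwall's inequality applies. A solution therefore cannot approach the unit
  circle in finite time.
\<close>

lemma generator_ode_norm_bound:
  assumes "a \<le> b" and ac: "abs_continuous_on_Icc a b x"
    and g: "g absolutely_integrable_on {a..b}"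
    and N: "negligible N"
    and ode: "\<And>t. t \<in> {a<..<b} - N \<Longrightarrow> (x has_vector_derivative G (x t) t) (at t)"
    and disc: "\<And>t. t \<in> {a<..<b} - N \<Longrightarrow> x t \<in> unit_disc"
    and gen: "\<And>t. t \<in> {a<..<b} - N \<Longrightarrow> (\<lambda>z. G z t) \<in> Gen_disc"
    and G0: "\<And>t. t \<in> {a<..<b} - N \<Longrightarrow> norm (G 0 t) \<le> g t"
  shows "(1 - (norm (x a))\<^sup>2) * exp (- 2 * integral {a..b} g) \<le> 1 - (norm (x b))\<^sup>2"
proof -
  define h where "h = (\<lambda>t. (norm (x t))\<^sup>2 - 1)"
  have "h b \<le> h a * exp (integral {a..b} (\<lambda>t. - 2 * g t))"
  proof (rule abs_continuous_gronwall[OF assms(1) _ _ N, where h' = "\<lambda>t. 2 * (x t \<bullet> G (x t) t)"])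
    have "abs_continuous_on_Icc a b (\<lambda>_. 0)"
      using ac ac by (rule abs_continuous_on_Icc_controlled[where C = 0]) auto
    from abs_continuous_on_Icc_norm_diff_sq[OF ac this]
    have s: "abs_continuous_on_Icc a b (\<lambda>t. of_real ((norm (x t))\<^sup>2))" by simp
    show "abs_continuous_on_Icc a b (\<lambda>t. of_real (h t))"
      using s s by (rule abs_continuous_on_Icc_controlled[where C = 1]) (simp add: h_def)
    show "(\<lambda>t. - 2 * g t) absolutely_integrable_on {a..b}"
      using g by (intro set_integrable_mult_right) auto
    fix t assume t: "t \<in> {a<..<b} - N"
    have "((\<lambda>t. x t \<bullet> x t) has_vector_derivative x t \<bullet> G (x t) t + G (x t) t \<bullet> x t) (at t)"
      by (rule bounded_bilinear.has_vector_derivative[OF bounded_bilinear_inner ode[OF t] ode[OF t]])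
    then have "((\<lambda>t. x t \<bullet> x t - 1) has_vector_derivative x t \<bullet> G (x t) t + G (x t) t \<bullet> x t - 0) (at t)"
      by (intro has_vector_derivative_diff has_vector_derivative_const)
    then show "(h has_vector_derivative 2 * (x t \<bullet> G (x t) t)) (at t)"
      by (simp add: h_def power2_norm_eq_inner inner_commute)
    have n1: "norm (x t) < 1" using disc[OF t] by simp
    have "x t \<bullet> G (x t) t \<le> norm (G 0 t) * (1 - (norm (x t))\<^sup>2)"
      using generator_radial_bound[OF gen[OF t] disc[OF t]] .
    also have "\<dots> \<le> g t * (1 - (norm (x t))\<^sup>2)"
      using G0[OF t] n1 by (intro mult_right_mono) (auto simp: power_le_one)
    finally show "2 * (x t \<bullet> G (x t) t) \<le> - 2 * g t * h t"
      by (simp add: h_def algebra_simps)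
  qed
  then show ?thesis by (simp add: h_def algebra_simps)
qed

text \<open>
  On a compact interval both solutions stay in some \<open>cball 0 R\<close> with \<open>R < 1\<close>, where the field is
  Lipschitz with an integrable constant.
\<close>

lemma Herglotz_solution_unique:
  assumes d: "1 \<le> d" and G: "Herglotz_vector_field d G"
    and ab: "0 \<le> a" "a \<le> b"
    and x: "solves_on G a b x" and y: "solves_on G a b y" and init: "x a = y a"
  shows "x b = y b"
proof (cases "a = b")
  case False
  then have "b > 0" using ab by simp
  have acx: "abs_continuous_on_Icc a b x" and acy: "abs_continuous_on_Icc a b y"
    using x y unfolding solves_on_def by auto
  have "compact (x ` {a..b} \<union> y ` {a..b})"
    using acx acy by (intro compact_Un compact_continuous_image abs_continuous_on_Icc_imp_continuous) auto
  then have "compact (norm ` (x ` {a..b} \<union> y ` {a..b}))"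
    by (intro compact_continuous_image continuous_intros)
  moreover have "norm ` (x ` {a..b} \<union> y ` {a..b}) \<noteq> {}" using ab by auto
  ultimately obtain R where R: "R \<in> norm ` (x ` {a..b} \<union> y ` {a..b})"
    "\<And>r. r \<in> norm ` (x ` {a..b} \<union> y ` {a..b}) \<Longrightarrow> r \<le> R"
    using compact_attains_sup by metis
  have "x ` {a..b} \<union> y ` {a..b} \<subseteq> unit_disc"
    using x y unfolding solves_on_def by auto
  then have R1: "0 \<le> R" "R < 1" using R(1) by auto
  have in_R: "x t \<in> cball 0 R" "y t \<in> cball 0 R" if "t \<in> {a..b}" for t
    using R(2) that by auto
  obtain L N where L: "L integrable_on {0..b}" "\<And>t. t \<in> {0..b} \<Longrightarrow> 0 \<le> L t" "negligible N"
    "\<And>t z w. t \<in> {0..b} - N \<Longrightarrow> z \<in> cball 0 R \<Longrightarrow> w \<in> cball 0 R \<Longrightarrow>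
       norm (G z t - G w t) \<le> L t * norm (z - w)"
    using Herglotz_vector_field_local_bounds[OF d G R1 \<open>b > 0\<close>] by metis
  have "L integrable_on {a..b}" using L(1) ab by (auto intro: integrable_on_subinterval)
  then have Labs: "L absolutely_integrable_on {a..b}"
    using L(2) ab by (intro nonnegative_absolutely_integrable_1) auto
  obtain Nx where Nx: "negligible Nx"
    "\<And>t. t \<in> {a<..<b} - Nx \<Longrightarrow> (x has_vector_derivative G (x t) t) (at t)"
    using x unfolding solves_on_def by blast
  obtain Ny where Ny: "negligible Ny"
    "\<And>t. t \<in> {a<..<b} - Ny \<Longrightarrow> (y has_vector_derivative G (y t) t) (at t)"
    using y unfolding solves_on_def by blast
  show ?thesis
  proof (rule caratheodory_uniqueness[OF ab(2) acx acy init Labs, where N = "N \<union> Nx \<union> Ny"])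
    show "negligible (N \<union> Nx \<union> Ny)" using L(3) Nx(1) Ny(1) by simp
    fix t assume t: "t \<in> {a<..<b} - (N \<union> Nx \<union> Ny)"
    show "(x has_vector_derivative G (x t) t) (at t)" "(y has_vector_derivative G (y t) t) (at t)"
      using Nx(2) Ny(2) t by auto
    show "norm (G (x t) t - G (y t) t) \<le> L t * norm (x t - y t)"
      using t ab by (intro L(4) in_R) auto
  qed
qed (use init in simp)

text \<open>
  The norm bound predicts, before any solution is known, a radius \<open>R < 1\<close> that solutions cannot reach
  up to time \<open>T\<close>. The field composed with the nearest-point projection onto \<open>cball 0 R\<close> (and set to
  zero at the exceptional times) is globally Lipschitz and has a solution on all of \<open>[s, T]\<close>. Until
  this solution first reaches radius \<open>R\<close> it solves the original equation, hence obeys the bound,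
  hence never gets there.
\<close>

lemma Herglotz_solution_exists:
  assumes d: "1 \<le> d" and G: "Herglotz_vector_field d G"
    and z: "z \<in> unit_disc" and sT: "0 \<le> s" "s < T"
  obtains x where "solves_on G s T x" "x s = z"
proof -
  have T: "0 < T" using sT by simp
  obtain g N0 where g: "g integrable_on {0..T}" "\<And>t. t \<in> {0..T} \<Longrightarrow> 0 \<le> g t" "negligible N0"
    "\<And>t z. t \<in> {0..T} - N0 \<Longrightarrow> z \<in> cball 0 0 \<Longrightarrow> norm (G z t) \<le> g t"
    using Herglotz_vector_field_local_bounds[OF d G order_refl zero_less_one T] by metis
  have gabs: "g absolutely_integrable_on {s..t}" if "t \<in> {s..T}" for t
    using g sT that by (intro nonnegative_absolutely_integrable_1) (auto intro: integrable_on_subinterval)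
  \<comment> \<open>The a priori lower bound for \<open>1 - \<bar>x t\<bar>\<^sup>2\<close> on \<open>[s, T]\<close>; taking half of it leaves room for a strict inequality.\<close>
  define m where "m = (1 - (norm z)\<^sup>2) * exp (- 2 * integral {s..T} g)"
  have z1: "(norm z)\<^sup>2 < 1" using z by (simp add: abs_square_less_1)
  have "integral {s..T} g \<ge> 0"
    using g sT by (intro integral_nonneg) (auto intro: integrable_on_subinterval)
  then have m: "0 < m" "m \<le> 1 - (norm z)\<^sup>2"
    using z1 by (auto simp: m_def intro!: mult_left_le)
  have m1: "m \<le> 1" using m(2) by (smt (verit) zero_le_power2)
  define R where "R = sqrt (1 - m / 2)"
  have R2: "R\<^sup>2 = 1 - m / 2" using m1 by (simp add: R_def)
  have R: "0 \<le> R" "R < 1" using m m1 by (auto simp: R_def)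
  obtain L N where L: "L integrable_on {0..T}" "\<And>t. t \<in> {0..T} \<Longrightarrow> 0 \<le> L t" "negligible N"
    "\<And>t. t \<in> {0..T} - N \<Longrightarrow> (\<lambda>z. G z t) \<in> Gen_disc"
    "\<And>t z. t \<in> {0..T} - N \<Longrightarrow> z \<in> cball 0 R \<Longrightarrow> norm (G z t) \<le> L t"
    "\<And>t z w. t \<in> {0..T} - N \<Longrightarrow> z \<in> cball 0 R \<Longrightarrow> w \<in> cball 0 R \<Longrightarrow>
       norm (G z t - G w t) \<le> L t * norm (z - w)"
    using Herglotz_vector_field_local_bounds[OF d G R T] by metis
  define P where "P = closest_point (cball (0::complex) R)"
  have P: "P w \<in> cball 0 R" "w \<in> cball 0 R \<Longrightarrow> P w = w" "norm (P w - P w') \<le> norm (w - w')" for w w'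
    using R closest_point_in_set[of "cball 0 R" w] closest_point_lipschitz[of "cball 0 R" w w']
    by (auto simp: P_def closest_point_self dist_norm)
  define H where "H = (\<lambda>w t. if t \<in> N then 0 else G (P w) t)"
  obtain x N' where x: "abs_continuous_on_Icc s T x" "x s = z" "negligible N'"
    "\<And>t. t \<in> {s<..<T} - N' \<Longrightarrow> (x has_vector_derivative H (x t) t) (at t)"
  proof (rule caratheodory_existence[of s T H L z])
    fix w
    have "P w \<in> unit_disc" using P(1)[of w] R by simp
    then have "(\<lambda>t. G (P w) t) \<in> borel_measurable (lebesgue_on {0..})"
      using G unfolding Herglotz_vector_field_def weak_holomorphic_vector_field_def by blast
    then have "(\<lambda>t. G (P w) t) \<in> borel_measurable (lebesgue_on {s..T})"
      by (rule measurable_restrict_mono) (use sT in auto)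
    moreover have "N \<inter> space (lebesgue_on {s..T}) \<in> sets (lebesgue_on {s..T})"
      using L(3) by (auto simp: sets_restrict_space space_restrict_space negligible_imp_sets)
    ultimately show "H w \<in> borel_measurable (lebesgue_on {s..T})"
      unfolding H_def by (intro measurable_If_set) auto
  next
    show "L integrable_on {s..T}" using L(1) sT by (auto intro: integrable_on_subinterval)
  next
    fix u w t assume t: "t \<in> {s..T}"
    show "norm (H u t - H w t) \<le> L t * norm (u - w)"
    proof (cases "t \<in> N")
      case False
      then have "norm (H u t - H w t) \<le> L t * norm (P u - P w)"
        using t sT P(1) by (auto simp: H_def intro!: L(6))
      also have "\<dots> \<le> L t * norm (u - w)"
        using L(2) t sT P(3) by (intro mult_left_mono) auto
      finally show ?thesis .
    qed (use L(2) t sT in \<open>auto simp: H_def\<close>)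
  next
    fix w t assume t: "t \<in> {s..T}"
    show "norm (H w t) \<le> L t"
      using t sT P(1) L(2) L(5)[of t "P w"] by (auto simp: H_def)
  qed (use sT L(2) in auto)
  have xcont: "continuous_on {s..T} x" by (rule abs_continuous_on_Icc_imp_continuous[OF x(1)])
  have ode: "(x has_vector_derivative G (x t) t) (at t)"
    if "t \<in> {s<..<T} - (N \<union> N')" "norm (x t) < R" for t
    using x(4)[of t] that P(2)[of "x t"] by (simp add: H_def)
  have inR: "norm (x t) < R" if t: "t \<in> {s..T}" for t
  proof (rule ccontr)
    assume bad: "\<not> norm (x t) < R"
    \<comment> \<open>Consider the first time \<open>t0\<close> at which radius \<open>R\<close> is reached.\<close>
    define A where "A = {t \<in> {s..T}. R \<le> norm (x t)}"
    have "closed A"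
      unfolding A_def
      by (rule continuous_on_closed_Collect_le[OF continuous_on_const continuous_on_norm[OF xcont]]) simp
    moreover have "bounded A" by (rule bounded_subset[of "{s..T}"]) (auto simp: A_def)
    ultimately have "compact A" by (simp add: compact_eq_bounded_closed)
    moreover have "A \<noteq> {}" using t bad by (auto simp: A_def)
    ultimately obtain t0 where t0: "t0 \<in> A" "\<And>u. u \<in> A \<Longrightarrow> t0 \<le> u"
      using compact_attains_inf by metis
    have t0s: "t0 \<in> {s..T}" using t0(1) by (simp add: A_def)
    have before: "norm (x u) < R" if "u \<in> {s<..<t0}" for u
    proof -
      have "u \<notin> A" using t0(2)[of u] that by auto
      then show ?thesis using that t0s by (auto simp: A_def not_le)
    qed
    have "(1 - (norm (x s))\<^sup>2) * exp (- 2 * integral {s..t0} g) \<le> 1 - (norm (x t0))\<^sup>2"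
    proof (rule generator_ode_norm_bound[OF _ _ gabs[OF t0s], where N = "N \<union> N' \<union> N0"])
      show "abs_continuous_on_Icc s t0 x"
        using x(1) t0s by (auto intro: abs_continuous_on_Icc_subset)
      show "negligible (N \<union> N' \<union> N0)" using L(3) x(3) g(3) by simp
      fix u assume u: "u \<in> {s<..<t0} - (N \<union> N' \<union> N0)"
      show "(x has_vector_derivative G (x u) u) (at u)" using u t0s before[of u] by (intro ode) auto
      show "x u \<in> unit_disc" using before[of u] u R by auto
      show "(\<lambda>z. G z u) \<in> Gen_disc" using u t0s sT by (intro L(4)) auto
      show "norm (G 0 u) \<le> g u" using u t0s sT by (intro g(4)) auto
    qed (use t0s in auto)
    moreover have "m \<le> (1 - (norm (x s))\<^sup>2) * exp (- 2 * integral {s..t0} g)"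
    proof -
      have "integral {s..t0} g \<le> integral {s..T} g"
        using g sT t0s by (intro integral_subset_le) (auto intro: integrable_on_subinterval)
      then show ?thesis unfolding m_def x(2) using z1 by (intro mult_left_mono) auto
    qed
    moreover have "R\<^sup>2 \<le> (norm (x t0))\<^sup>2"
      using t0(1) R by (intro power_mono) (auto simp: A_def)
    ultimately show False using R2 m(1) by linarith
  qed
  have "solves_on G s T x"
    unfolding solves_on_def
  proof (intro conjI exI[of _ "N \<union> N'"] ballI)
    show "x ` {s..T} \<subseteq> unit_disc" using inR R by force
    show "negligible (N \<union> N')" using L(3) x(3) by simp
    show "(x has_vector_derivative G (x t) t) (at t)" if "t \<in> {s<..<T} - (N \<union> N')" for t
      using that inR[of t] by (intro ode) auto
  qed (rule x(1))
  then show ?thesis using x(2) that by blast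
qed

lemma time_interval_lebesgue: "time_interval s I \<in> sets lebesgue"
proof (cases I)
  case (real r)
  then have "time_interval s I = {s..<r}" by (auto simp: time_interval_def)
  then show ?thesis by simp
next
  case PInf
  then have "time_interval s I = {s..}" by (auto simp: time_interval_def)
  then show ?thesis by simp
next
  case MInf
  then have "time_interval s I = {}" by (auto simp: time_interval_def)
  then show ?thesis by simp
qed

lemma solves_ivp_imp_solves_on:
  assumes x: "solves_ivp G z s I x" and b: "s \<le> b" "ereal b < I"
  shows "solves_on G s b x"
proof -
  have sub: "{s..b} \<subseteq> time_interval s I"
    using b by (auto simp: time_interval_def intro: le_less_trans[of _ "ereal b"])
  define N where "N = {t \<in> time_interval s I.
      \<not> (x has_vector_derivative G (x t) t) (at t within time_interval s I)}"
  have "AE t in lebesgue_on (time_interval s I).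
      (x has_vector_derivative G (x t) t) (at t within time_interval s I)"
    using x unfolding solves_ivp_def by blast
  then have N: "negligible N"
    unfolding N_def AE_lebesgue_on_iff_negligible[OF time_interval_lebesgue] .
  have "(x has_vector_derivative G (x t) t) (at t)" if t: "t \<in> {s<..<b} - N" for t
  proof -
    have "(x has_vector_derivative G (x t) t) (at t within time_interval s I)"
      using t subsetD[OF sub, of t] by (simp add: N_def)
    moreover have "at t within time_interval s I = at t"
    proof (rule at_within_open_subset)
      show "t \<in> {s<..<b}" using t by simp
      show "{s<..<b} \<subseteq> time_interval s I" using sub by auto
    qed simp
    ultimately show ?thesis by simp
  qed
  then show ?thesis
    using x N sub b unfolding solves_on_def solves_ivp_def locally_abs_continuous_on_def by blast
qed

section \<open>Semicompleteness\<close>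

theorem theorem4p4:
  fixes d :: real and G :: "complex \<Rightarrow> real \<Rightarrow> complex"
  assumes "1 \<le> d" and "Herglotz_vector_field d G"
  shows "semicomplete G"
  unfolding semicomplete_def
proof (intro ballI allI impI)
  fix z :: complex and s :: real
  assume z: "z \<in> unit_disc" and s: "0 \<le> s"
  define b where "b = (\<lambda>n. s + real (Suc n))"
  have bs: "s < b n" for n by (simp add: b_def)
  have "\<exists>x. solves_on G s (b n) x \<and> x s = z" for n
    using Herglotz_solution_exists[OF assms z s bs] by metis
  then obtain X where X: "\<And>n. solves_on G s (b n) (X n)" "\<And>n. X n s = z"
    by metis
  \<comment> \<open>The solutions \<open>X n\<close> agree wherever two of them are defined, so any index with \<open>t \<le> b n\<close> may be used at time \<open>t\<close>.\<close>
  define idx where "idx = (\<lambda>t. nat \<lceil>t - s\<rceil>)"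
  have idx: "t \<le> b (idx t)" if "s \<le> t" for t
    using that unfolding idx_def b_def by linarith
  define x where "x = (\<lambda>t. X (idx t) t)"
  have unique: "y t = y' t"
    if "solves_on G s c y" "solves_on G s c' y'" "y s = y' s" "t \<in> {s..c}" "t \<le> c'" for y y' c c' t
    using that by (intro Herglotz_solution_unique[OF assms s, of t y y']) (auto intro: solves_on_subset)
  have xX: "x t = X n t" if "t \<in> {s..b n}" for t n
    unfolding x_def
    by (rule unique[OF X(1)[of "idx t"] X(1)[of n]]) (use idx[of t] that in \<open>auto simp: X(2)\<close>)
  have large: "\<exists>n. t < b n" for t
  proof -
    obtain n where "t - s < real n" using reals_Archimedean2 by blast
    then show ?thesis by (intro exI[of _ n]) (simp add: b_def)
  qed
  have xs: "x s = z" by (simp add: x_def X(2))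
  have ti: "time_interval s \<infinity> = {s..}" by (auto simp: time_interval_def)
  have sol: "solves_ivp G z s \<infinity> x"
    unfolding solves_ivp_def
  proof (intro conjI)
    show "x ` time_interval s \<infinity> \<subseteq> unit_disc"
      unfolding ti x_def using X(1) idx unfolding solves_on_def by fastforce
    show "locally_abs_continuous_on (time_interval s \<infinity>) x"
      unfolding locally_abs_continuous_on_def ti
    proof (intro allI impI)
      fix a c :: real assume ac: "a \<le> c \<and> {a..c} \<subseteq> {s..}"
      then have "s \<le> a" by auto
      obtain n where n: "c < b n" using large by blast
      have "abs_continuous_on_Icc a c (X n)"
        using X(1)[of n] \<open>s \<le> a\<close> n unfolding solves_on_def by (auto intro: abs_continuous_on_Icc_subset)
      then show "abs_continuous_on_Icc a c x"
        by (rule abs_continuous_on_Icc_cong) (use xX[of _ n] \<open>s \<le> a\<close> n in auto)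
    qed
    have "\<exists>N. negligible N \<and> (\<forall>t\<in>{s<..<b n} - N. (X n has_vector_derivative G (X n t) t) (at t))" for n
      using X(1)[of n] unfolding solves_on_def by blast
    then obtain N where N: "\<And>n. negligible (N n)"
      "\<And>n t. t \<in> {s<..<b n} - N n \<Longrightarrow> (X n has_vector_derivative G (X n t) t) (at t)"
      by metis
    have "(x has_vector_derivative G (x t) t) (at t within {s..})"
      if t: "t \<in> {s..} - insert s (\<Union>n. N n)" for t
    proof -
      obtain n where n: "t < b n" using large by blast
      have "(X n has_vector_derivative G (X n t) t) (at t)"
        using t n by (intro N(2)) auto
      then have "(x has_vector_derivative G (X n t) t) (at t)"
        by (rule has_vector_derivative_transform_within_open[where S = "{s<..<b n}"])
          (use t n in \<open>auto simp: xX[of _ n]\<close>)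
      then show ?thesis
        using xX[of t n] t n by (auto intro: has_vector_derivative_at_within)
    qed
    then have "{t \<in> {s..}. \<not> (x has_vector_derivative G (x t) t) (at t within {s..})}
        \<subseteq> insert s (\<Union>n. N n)" by blast
    moreover have "negligible (insert s (\<Union>n. N n))"
      using negligible_countable_Union[of "range N"] N(1) by auto
    ultimately show "AE t in lebesgue_on (time_interval s \<infinity>).
        (x has_vector_derivative G (x t) t) (at t within time_interval s \<infinity>)"
      unfolding ti by (subst AE_lebesgue_on_iff_negligible) (simp, rule negligible_subset)
  qed (simp_all add: xs)
  have "maximal_solution G z s \<infinity> x"
    unfolding maximal_solution_def
  proof (intro conjI allI impI ballI)
    fix J y t assume y: "solves_ivp G z s J y"
    show "J \<le> \<infinity>" by simp
    assume "t \<in> time_interval s J"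
    then have t: "s \<le> t" "ereal t < J" by (auto simp: time_interval_def)
    show "y t = x t"
    proof (rule unique)
      show "solves_on G s t y" by (rule solves_ivp_imp_solves_on[OF y t])
      show "solves_on G s t x" by (rule solves_ivp_imp_solves_on[OF sol]) (use t in auto)
      show "y s = x s" using y xs by (simp add: solves_ivp_def)
    qed (use t in auto)
  qed (rule sol)
  then show "\<exists>x. maximal_solution G z s \<infinity> x" by blast
qed

end
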